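(* Let $G$ be a finitely generated nilpotent group. Then $\mathrm{cb}(G)=h(G)$, where $h(G)$ is the Hirsch length of $G$ (the number of infinite cyclic factors in any subnormal series of $G$ with cyclic factors).
   Context: For a discrete group $G$, let $\mathcal{N}(G)$ be the set of normal subgroups of $G$, with the topology of pointwise convergence, i.e. the subspace topology from $\{0,1\}^G$ (subsets identified with indicator functions). For a topological space $X$, set $X^{(0)}=X$, $X^{(\alpha+1)}$ = the set of accumulation points (non-isolated points) of the space $X^{(\alpha)}$, and $X^{(\lambda)}=\bigcap_{\beta<\lambda}X^{(\beta)}$ for limit ordinals $\lambda$. For $x\in X$, $\mathrm{CB}_X(x)=\sup\{\alpha : x\in X^{(\alpha)}\}$ if this supremum exists (it is then a maximum); otherwise $\mathrm{CB}_X(x)=\mathfrak{C}$, where $\mathfrak{C}$ is a symbol that is not an ordinal. The Cantor-Bendixson rank of $G$ is $\mathrm{cb}(G)=\mathrm{CB}_{\mathcal{N}(G)}(\{1\})$. *)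

theory Defs
  imports "HOL-Algebra.Elementary_Groups" "HOL-Analysis.Function_Topology"
begin

section \<open>Ordinals\<close>

text \<open>
  HOL has no type of all ordinals. The type \<open>'b ordinal\<close> consists of the order types of
  the well-orders whose field is a set of elements of \<open>'b\<close>, that is, of the ordinals of cardinality
  at most that of \<open>'b\<close>.
\<close>

quotient_type 'b ordinal = "'b rel" / partial: "\<lambda>r s. (r, s) \<in> ordIso"
proof (rule part_equivpI)
  show "\<exists>r :: 'b rel. (r, r) \<in> ordIso"
    using card_of_Well_order ordIso_reflexive by blast
  show "symp (\<lambda>r s :: 'b rel. (r, s) \<in> ordIso)"
    by (auto intro: sympI ordIso_symmetric)
  show "transp (\<lambda>r s :: 'b rel. (r, s) \<in> ordIso)"
    by (auto intro: transpI ordIso_transitive)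
qed

lemma ordIso_self_iff: "(r, r) \<in> ordIso \<longleftrightarrow> Well_order r"
  using ordIso_reflexive ordIso_def by blast

instantiation ordinal :: (type) wellorder
begin

lift_definition less_eq_ordinal :: "'a ordinal \<Rightarrow> 'a ordinal \<Rightarrow> bool"
  is "\<lambda>r s. (r, s) \<in> ordLeq"
  by (meson ordIso_ordLeq_trans ordIso_symmetric ordLeq_ordIso_trans)

lift_definition less_ordinal :: "'a ordinal \<Rightarrow> 'a ordinal \<Rightarrow> bool"
  is "\<lambda>r s. (r, s) \<in> ordLess"
  by (meson ordIso_ordLess_trans ordIso_symmetric ordLess_ordIso_trans)

instance
proof
  fix x y z :: "'a ordinal"
  show "(x < y) = (x \<le> y \<and> \<not> y \<le> x)"
    by transfer (metis not_ordLess_iff_ordLeq ordIso_self_iff ordLess_imp_ordLeq)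
  show "x \<le> x"
    by transfer (simp add: ordIso_self_iff ordLeq_reflexive)
  show "x \<le> y \<Longrightarrow> y \<le> z \<Longrightarrow> x \<le> z"
    by transfer (rule ordLeq_transitive)
  show "x \<le> y \<Longrightarrow> y \<le> x \<Longrightarrow> x = y"
    by transfer (simp add: ordIso_iff_ordLeq)
  show "x \<le> y \<or> y \<le> x"
    by transfer (simp add: ordIso_self_iff ordLeq_total)
next
  fix P :: "'a ordinal \<Rightarrow> bool" and a :: "'a ordinal"
  assume step: "\<And>x. (\<And>y. y < x \<Longrightarrow> P y) \<Longrightarrow> P x"
  have "wf {(x, y :: 'a ordinal). x < y}"
  proof (rule wf_subset)
    show "wf (inv_image (ordLess :: 'a rel rel) rep_ordinal)"
      by (rule wf_inv_image) (rule wf_ordLess)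
    show "{(x, y :: 'a ordinal). x < y} \<subseteq> inv_image ordLess rep_ordinal"
      by (auto simp: less_ordinal.rep_eq)
  qed
  then show "P a"
    by (induction a rule: wf_induct_rule) (use step in blast)
qed

end

text \<open>There is no largest ordinal of this kind if \<open>'b\<close> is infinite.\<close>

lemma ordinal_no_top:
  assumes "infinite (UNIV :: 'b set)"
  shows "\<exists>\<beta>. (\<alpha> :: 'b ordinal) < \<beta>"
proof -
  obtain r :: "'b rel" where r: "Well_order r" and \<alpha>: "\<alpha> = abs_ordinal r"
    using Quotient_rel_rep[OF Quotient_ordinal, of \<alpha> \<alpha>] Quotient_abs_rep[OF Quotient_ordinal, of \<alpha>]
    by (auto simp: ordIso_self_iff)
  obtain f :: "'b \<Rightarrow> 'b" and u where f: "bij_betw f UNIV (UNIV - {u})"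
    using infinite_imp_bij_betw[OF assms] by blast
  then have inj: "inj_on f (Field r)" and u: "u \<notin> range f"
    by (auto simp: bij_betw_def inj_on_def)
  define s where "s = dir_image r f"
  have s: "Well_order s" and rs: "(r, s) \<in> ordIso"
    unfolding s_def using r inj by (simp_all add: Well_order_dir_image dir_image_ordIso)
  define F where "F = Field s"
  have uF: "u \<notin> F"
    using u by (auto simp: F_def s_def dir_image_Field)
  have sF: "(a, b) \<in> s \<Longrightarrow> a \<in> F \<and> b \<in> F" for a b
    by (auto simp: F_def Field_def)
  have s': "refl_on F s" "trans s" "antisym s" "total_on F s" "wf (s - Id)"
    using s by (simp_all add: order_on_defs well_order_on_def F_def)
  define t where "t = s \<union> insert u F \<times> {u}"
  have Ft: "Field t = insert u F"
    by (auto simp: t_def F_def Field_def)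
  have "Refl t"
    unfolding Ft using s'(1) by (auto simp: refl_on_def t_def)
  moreover have "trans t"
  proof (rule transI)
    fix a b c assume "(a, b) \<in> t" "(b, c) \<in> t"
    then show "(a, c) \<in> t"
      using sF uF transD[OF s'(2), of a b c] unfolding t_def by blast
  qed
  moreover have "antisym t"
  proof (rule antisymI)
    fix a b assume "(a, b) \<in> t" "(b, a) \<in> t"
    then show "a = b"
      using sF uF antisymD[OF s'(3), of a b] unfolding t_def by blast
  qed
  moreover have "Total t"
    unfolding Ft using s'(4) by (auto simp: total_on_def t_def)
  moreover have "wf (t - Id)"
  proof (rule wf_subset)
    have "wf (F \<times> {u})"
      using uF by (intro wfI_min) (metis SigmaE2 singletonD)
    then show "wf ((s - Id) \<union> F \<times> {u})"
      by (intro wf_Un s'(5)) (use sF uF in blast)+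
    show "t - Id \<subseteq> (s - Id) \<union> F \<times> {u}"
      by (auto simp: t_def)
  qed
  ultimately have t: "Well_order t"
    using Ft by (auto simp: order_on_defs well_order_on_def Field_def)
  have "wo_rel.ofilter t F"
    using t Ft sF uF by (auto simp: wo_rel.ofilter_def wo_rel_def under_def t_def)
  then have "(Restr t F, t) \<in> ordLess"
    using ofilter_ordLess[OF t] Ft uF by blast
  moreover have "Restr t F = s"
    using sF uF by (auto simp: t_def)
  ultimately have "(r, t) \<in> ordLess"
    using rs ordIso_ordLess_trans by metis
  then have "\<alpha> < abs_ordinal t"
    unfolding \<alpha> using r t by (simp add: less_ordinal.abs_eq ordIso_self_iff)
  then show ?thesis ..
qed

text \<open>\<open>n\<close>-th element of a well-order, i.e. the finite ordinal \<open>n\<close>.\<close>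

fun finite_ordinal :: "nat \<Rightarrow> 'o::wellorder" where
  "finite_ordinal 0 = (LEAST \<alpha>. True)"
| "finite_ordinal (Suc n) = (LEAST \<alpha>. finite_ordinal n < \<alpha>)"


section \<open>Cantor-Bendixson rank\<close>

definition is_pred :: "'o::wellorder \<Rightarrow> 'o \<Rightarrow> bool" where
  "is_pred \<beta> \<alpha> \<longleftrightarrow> \<beta> < \<alpha> \<and> (\<forall>\<gamma><\<alpha>. \<gamma> \<le> \<beta>)"

lemma is_pred_unique: "is_pred \<beta> \<alpha> \<Longrightarrow> is_pred \<gamma> \<alpha> \<Longrightarrow> \<beta> = \<gamma>"
  unfolding is_pred_def by (meson order_antisym)

lemma the_is_pred: "is_pred \<beta> \<alpha> \<Longrightarrow> (THE \<gamma>. is_pred \<gamma> \<alpha>) = \<beta>"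
  using is_pred_unique by blast

function cb_derivative :: "'x topology \<Rightarrow> 'o::wellorder \<Rightarrow> 'x set" where
  "cb_derivative X \<alpha> =
    (if \<forall>\<beta>. \<alpha> \<le> \<beta> then topspace X
     else if \<exists>\<beta>. is_pred \<beta> \<alpha> then
       let S = cb_derivative X (THE \<beta>. is_pred \<beta> \<alpha>)
       in subtopology X S derived_set_of S
     else (\<Inter>\<beta>\<in>{..<\<alpha>}. cb_derivative X \<beta>))"
  by auto
termination
  by (relation "inv_image {(\<beta>, \<alpha>). \<beta> < \<alpha>} snd")
    (auto simp: wf the_is_pred, auto simp: is_pred_def)

declare cb_derivative.simps [simp del]

lemma cb_derivative_zero:
  "cb_derivative X (LEAST \<alpha>. True) = topspace X"
  by (subst cb_derivative.simps) (simp add: Least_le)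

lemma cb_derivative_succ:
  assumes "is_pred \<beta> \<alpha>"
  shows "cb_derivative X \<alpha> =
    subtopology X (cb_derivative X \<beta>) derived_set_of cb_derivative X \<beta>"
proof -
  have "\<not> (\<forall>\<gamma>. \<alpha> \<le> \<gamma>)"
    using assms by (auto simp: is_pred_def not_le)
  then show ?thesis
    using assms the_is_pred[OF assms]
    by (subst cb_derivative.simps) (auto simp: Let_def)
qed

lemma cb_derivative_limit:
  assumes "\<beta> < \<alpha>" "\<And>\<beta>. \<not> is_pred \<beta> \<alpha>"
  shows "cb_derivative X \<alpha> = (\<Inter>\<gamma>\<in>{..<\<alpha>}. cb_derivative X \<gamma>)"
  using assms by (subst cb_derivative.simps) (auto simp: not_le[symmetric])

text \<open>
  The result \<open>None\<close> is the symbol that is not an ordinal. The ordinals of type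
  \<open>('x + nat) ordinal\<close> are those of cardinality at most \<open>\<kappa>\<close>, where \<open>\<kappa>\<close> is the larger of
  \<open>\<aleph>\<^sub>0\<close> and the cardinality of \<open>'x\<close>. They suffice: the derivatives of a space with at most
  \<open>\<kappa>\<close> points become stationary at such an ordinal, and these ordinals are closed
  under successors.
\<close>

definition cb_rank_at :: "'x topology \<Rightarrow> 'x \<Rightarrow> ('x + nat) ordinal option" where
  "cb_rank_at X x =
    (let S = {\<alpha> :: ('x + nat) ordinal. x \<in> cb_derivative X \<alpha>}
     in if \<exists>\<beta>. \<forall>\<alpha>\<in>S. \<alpha> \<le> \<beta>
        then Some (LEAST \<beta>. \<forall>\<alpha>\<in>S. \<alpha> \<le> \<beta>)
        else None)"


section \<open>Groups\<close>

text \<open>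
  A subgroup is identified with its indicator function, so the topology is pulled back
  along this identification.
\<close>

definition normal_subgroup_space :: "('a, 'c) monoid_scheme \<Rightarrow> 'a set topology" where
  "normal_subgroup_space G =
    pullback_topology {N. N \<lhd> G} (\<lambda>N. \<lambda>g\<in>carrier G. g \<in> N)
      (product_topology (\<lambda>_. discrete_topology (UNIV :: bool set)) (carrier G))"

definition cb_rank :: "('a, 'c) monoid_scheme \<Rightarrow> ('a set + nat) ordinal option" where
  "cb_rank G = cb_rank_at (normal_subgroup_space G) {\<one>\<^bsub>G\<^esub>}"

definition finitely_generated :: "('a, 'c) monoid_scheme \<Rightarrow> bool" where
  "finitely_generated G \<longleftrightarrow> (\<exists>S \<subseteq> carrier G. finite S \<and> generate G S = carrier G)"

fun lower_central_series :: "('a, 'c) monoid_scheme \<Rightarrow> nat \<Rightarrow> 'a set" where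
  "lower_central_series G 0 = carrier G"
| "lower_central_series G (Suc n) =
    generate G (\<Union>x\<in>lower_central_series G n. \<Union>y\<in>carrier G.
      {x \<otimes>\<^bsub>G\<^esub> y \<otimes>\<^bsub>G\<^esub> inv\<^bsub>G\<^esub> x \<otimes>\<^bsub>G\<^esub> inv\<^bsub>G\<^esub> y})"

definition nilpotent :: "('a, 'c) monoid_scheme \<Rightarrow> bool" where
  "nilpotent G \<longleftrightarrow> (\<exists>n. lower_central_series G n = {\<one>\<^bsub>G\<^esub>})"

abbreviation series_factor ::
  "('a, 'c) monoid_scheme \<Rightarrow> (nat \<Rightarrow> 'a set) \<Rightarrow> nat \<Rightarrow> 'a set monoid" where
  "series_factor G H i \<equiv> G\<lparr>carrier := H (Suc i)\<rparr> Mod H i"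

definition cyclic_subnormal_series ::
  "('a, 'c) monoid_scheme \<Rightarrow> nat \<Rightarrow> (nat \<Rightarrow> 'a set) \<Rightarrow> bool" where
  "cyclic_subnormal_series G k H \<longleftrightarrow>
    H 0 = {\<one>\<^bsub>G\<^esub>} \<and> H k = carrier G \<and> (\<forall>i\<le>k. subgroup (H i) G) \<and>
    (\<forall>i<k. H i \<lhd> G\<lparr>carrier := H (Suc i)\<rparr> \<and> cyclic_group (series_factor G H i))"

text \<open>The number of infinite factors is the same for all such series of a given group.\<close>

definition hirsch_length :: "('a, 'c) monoid_scheme \<Rightarrow> nat" where
  "hirsch_length G =
    (THE n. \<exists>k H. cyclic_subnormal_series G k H \<and>
      n = card {i. i < k \<and> infinite (carrier (series_factor G H i))})"

end

theory Submission
  imports Defs "HOL-Algebra.Zassenhaus" "HOL-Algebra.Multiplicative_Group"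
begin

text \<open>
  Let \<open>d K\<close> be the largest length of a chain of subgroups of \<open>K\<close> in which every step has infinite
  index. An extension with finite cyclic factor preserves \<open>d\<close> and one with infinite cyclic factor
  raises it by one, so \<open>d G\<close> counts the infinite factors of any series of \<open>G\<close> with cyclic factors,
  and \<open>d\<close> is finite on the subgroups of \<open>G\<close>. The \<open>n\<close>-th derivative of the space of normal subgroups
  consists of the \<open>N\<close> with \<open>d N + n \<le> d G\<close>; this is shown by induction on \<open>n\<close>. Since \<open>N\<close> is finitely
  generated and there is a largest normal subgroup containing \<open>N\<close> with finite index, every
  \<open>M \<noteq> N\<close> in a small neighbourhood of \<open>N\<close> contains \<open>N\<close> with infinite index, whence \<open>d N < d M\<close>.
  Conversely, if \<open>N\<close> has infinite index in \<open>G\<close>, then \<open>G\<close> modulo \<open>N\<close> has a central element \<open>z\<close> of infinite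
  order, and the subgroups generated by \<open>N\<close> and \<open>z\<^sup>j\<close> converge to \<open>N\<close> and have \<open>d \<le> d N + 1\<close>.
\<close>

section \<open>Subgroups of finite index\<close>

context group
begin

lemma inv_mult_cancel:
  assumes "x \<in> carrier G" "y \<in> carrier G"
  shows "x \<otimes> (inv x \<otimes> y) = y" "inv x \<otimes> (x \<otimes> y) = y"
  using assms by (simp_all add: m_assoc[symmetric])

text \<open>Finitely many right cosets of \<open>H\<close> cover \<open>K\<close>, with
  representatives anywhere in \<open>G\<close>. In this form the relation passes directly to larger
  \<open>H\<close> and smaller \<open>K\<close>, and it makes sense when \<open>H\<close> is not
  contained in \<open>K\<close>.\<close>

definition finite_index :: "'a set \<Rightarrow> 'a set \<Rightarrow> bool" where
  "finite_index H K \<longleftrightarrow> (\<exists>F. finite F \<and> F \<subseteq> carrier G \<and> (\<forall>k\<in>K. \<exists>f\<in>F. k \<otimes> inv f \<in> H))"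

lemma finite_indexI:
  assumes "finite F" "F \<subseteq> carrier G" "\<And>k. k \<in> K \<Longrightarrow> \<exists>f\<in>F. k \<otimes> inv f \<in> H"
  shows "finite_index H K"
  using assms unfolding finite_index_def by blast

lemma finite_index_mono:
  assumes "finite_index H K" "H \<subseteq> H'" "K' \<subseteq> K"
  shows "finite_index H' K'"
proof -
  obtain F where "finite F" "F \<subseteq> carrier G" "\<forall>k\<in>K. \<exists>f\<in>F. k \<otimes> inv f \<in> H"
    using assms(1) unfolding finite_index_def by blast
  then show ?thesis using assms(2,3) by (intro finite_indexI[of F]) blast+
qed

lemma finite_index_trans:
  assumes "finite_index A B" "finite_index B C" "C \<subseteq> carrier G"
  shows "finite_index A C"
proof -
  obtain E where E: "finite E" "E \<subseteq> carrier G" "\<forall>b\<in>B. \<exists>e\<in>E. b \<otimes> inv e \<in> A"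
    using assms(1) unfolding finite_index_def by blast
  obtain F where F: "finite F" "F \<subseteq> carrier G" "\<forall>c\<in>C. \<exists>f\<in>F. c \<otimes> inv f \<in> B"
    using assms(2) unfolding finite_index_def by blast
  show ?thesis
  proof (rule finite_indexI)
    show "finite ((\<lambda>(e, f). e \<otimes> f) ` (E \<times> F))"
      using E F by blast
    show "(\<lambda>(e, f). e \<otimes> f) ` (E \<times> F) \<subseteq> carrier G"
      using E F by auto
    fix c assume c: "c \<in> C"
    obtain f where f: "f \<in> F" "c \<otimes> inv f \<in> B"
      using F(3) c by blast
    obtain e where e: "e \<in> E" "c \<otimes> inv f \<otimes> inv e \<in> A"
      using E(3) f(2) by blast
    have "c \<otimes> inv (e \<otimes> f) = c \<otimes> inv f \<otimes> inv e"
      using e f c E F assms(3) by (subst inv_mult_group) (auto simp: m_assoc subset_iff)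
    then show "\<exists>x\<in>(\<lambda>(e, f). e \<otimes> f) ` (E \<times> F). c \<otimes> inv x \<in> A"
      using e f by (metis (no_types, lifting) SigmaI case_prod_conv image_eqI)
  qed
qed

text \<open>A coset of \<open>H\<close> that meets \<open>K\<close> is represented by any of its
  elements in \<open>K\<close>, so each given representative is exchanged for such an element, and
  those whose coset misses \<open>K\<close> are dropped.\<close>

lemma finite_index_transversal:
  assumes "subgroup H G" "K \<subseteq> carrier G" "finite_index H K"
  obtains F where "finite F" "F \<subseteq> K" "\<And>k. k \<in> K \<Longrightarrow> \<exists>f\<in>F. k \<otimes> inv f \<in> H"
proof -
  obtain E where E: "finite E" "E \<subseteq> carrier G" "\<forall>k\<in>K. \<exists>f\<in>E. k \<otimes> inv f \<in> H"
    using assms(3) unfolding finite_index_def by blast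
  define r where "r e = (SOME k. k \<in> K \<and> k \<otimes> inv e \<in> H)" for e
  define E' where "E' = {e\<in>E. \<exists>k\<in>K. k \<otimes> inv e \<in> H}"
  have r: "r e \<in> K \<and> r e \<otimes> inv e \<in> H" if "e \<in> E'" for e
    unfolding r_def by (rule someI_ex) (use that in \<open>auto simp: E'_def\<close>)
  show thesis
  proof
    show "finite (r ` E')" "r ` E' \<subseteq> K"
      using E(1) r by (auto simp: E'_def)
    fix k assume k: "k \<in> K"
    then obtain e where e: "e \<in> E" "k \<otimes> inv e \<in> H" using E by blast
    then have e': "e \<in> E'" using k by (auto simp: E'_def)
    have c: "k \<in> carrier G" "e \<in> carrier G" "r e \<in> carrier G"
      using k e E r[OF e'] assms(2) by auto
    have "(k \<otimes> inv e) \<otimes> inv (r e \<otimes> inv e) \<in> H"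
      using r[OF e'] e assms(1) by (simp add: subgroupE)
    also have "(k \<otimes> inv e) \<otimes> inv (r e \<otimes> inv e) = k \<otimes> inv (r e)"
      using c by (simp add: m_assoc inv_mult_group inv_mult_cancel)
    finally show "\<exists>f\<in>r ` E'. k \<otimes> inv f \<in> H" using e' by blast
  qed
qed

lemma finite_index_Int:
  assumes "subgroup H G" "subgroup K G" "finite_index H K"
  shows "finite_index (H \<inter> K) K"
proof -
  obtain F where F: "finite F" "F \<subseteq> K" "\<And>k. k \<in> K \<Longrightarrow> \<exists>f\<in>F. k \<otimes> inv f \<in> H"
    using finite_index_transversal[of H K] assms subgroup.subset by metis
  show ?thesis
  proof (rule finite_indexI[OF F(1)])
    show "F \<subseteq> carrier G" using F assms subgroup.subset by blast
    show "\<exists>f\<in>F. k \<otimes> inv f \<in> H \<inter> K" if "k \<in> K" for k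
      using F(2) F(3)[OF that] that assms(2) by (metis IntI subgroup_def subsetD)
  qed
qed

text \<open>
  The supremum of the \<open>n\<close> satisfying this predicate is, for a polycyclic group, the Hirsch length,
  here defined without reference to a series with cyclic factors.
\<close>

primrec infinite_index_chain :: "nat \<Rightarrow> 'a set \<Rightarrow> bool" where
  "infinite_index_chain 0 K \<longleftrightarrow> True"
| "infinite_index_chain (Suc n) K \<longleftrightarrow>
    (\<exists>H. subgroup H G \<and> H \<subseteq> K \<and> \<not> finite_index H K \<and> infinite_index_chain n H)"

lemma infinite_index_chain_mono:
  assumes "infinite_index_chain n H" "H \<subseteq> K"
  shows "infinite_index_chain n K"
proof (cases n)
  case (Suc m)
  then obtain L where "subgroup L G" "L \<subseteq> H" "\<not> finite_index L H" "infinite_index_chain m L"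
    using assms(1) by auto
  moreover have "\<not> finite_index L K"
    using calculation(3) assms(2) finite_index_mono by blast
  ultimately show ?thesis using Suc assms(2) by auto
qed simp

lemma infinite_index_chain_antimono:
  assumes "infinite_index_chain n K" "m \<le> n"
  shows "infinite_index_chain m K"
  using assms(2,1)
proof (induction rule: dec_induct)
  case (step n)
  then show ?case by (meson infinite_index_chain.simps(2) infinite_index_chain_mono)
qed

text \<open>The chain is intersected with \<open>H\<close>: for its first member \<open>L\<close>,
  the group \<open>H \<inter> L\<close> has finite index in \<open>L\<close>, so the induction
  hypothesis applies to it. If it had finite index in \<open>H\<close>, transitivity would give
  \<open>L\<close> finite index in \<open>K\<close>.\<close>

lemma infinite_index_chain_finite_index:
  assumes "subgroup H G" "subgroup K G" "H \<subseteq> K" "finite_index H K" "infinite_index_chain n K"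
  shows "infinite_index_chain n H"
  using assms
proof (induction n arbitrary: H K)
  case (Suc n)
  then obtain L where L: "subgroup L G" "L \<subseteq> K" "\<not> finite_index L K" "infinite_index_chain n L"
    by auto
  have LH: "subgroup (H \<inter> L) G"
    using L Suc by (simp add: subgroups_Inter_pair)
  have "finite_index (H \<inter> L) L"
    using L Suc finite_index_mono[of H K H L] by (intro finite_index_Int) auto
  then have "infinite_index_chain n (H \<inter> L)"
    using Suc.IH[OF LH L(1)] L by blast
  moreover have "\<not> finite_index (H \<inter> L) H"
    using L(3) Suc.prems finite_index_trans[of "H \<inter> L" H K] finite_index_mono[of "H \<inter> L" K L K]
      subgroup.subset by blast
  ultimately show ?case using LH by auto
qed simp

section \<open>Cyclic extensions and polycyclic groups\<close>

text \<open>\<open>H\<close> is normal in \<open>K\<close>, and the coset of \<open>x\<close>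
  generates \<open>K / H\<close>. The elementwise form keeps every group inside \<open>G\<close>, so
  intersecting with a subgroup needs no change of carrier.\<close>

definition cyclic_extension :: "'a set \<Rightarrow> 'a set \<Rightarrow> 'a \<Rightarrow> bool" where
  "cyclic_extension H K x \<longleftrightarrow> subgroup H G \<and> subgroup K G \<and> H \<subseteq> K \<and>
    (\<forall>k\<in>K. \<forall>h\<in>H. k \<otimes> h \<otimes> inv k \<in> H) \<and>
    x \<in> K \<and> (\<forall>k\<in>K. \<exists>m::int. k \<otimes> inv (x [^] m) \<in> H)"

section \<open>Exponents modulo a normal subgroup\<close>

context
  fixes H K x
  assumes ext: "subgroup H G" "subgroup K G" "H \<subseteq> K" "\<And>k h. k \<in> K \<Longrightarrow> h \<in> H \<Longrightarrow> k \<otimes> h \<otimes> inv k \<in> H"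
    and x: "x \<in> K"
begin

lemma exponent_carrier: "k \<in> K \<Longrightarrow> k \<in> carrier G"
  using ext(2) subgroup.subset by blast

lemma exponent_conj: "k \<in> K \<Longrightarrow> h \<in> H \<Longrightarrow> inv k \<otimes> h \<otimes> k \<in> H"
  using ext(4)[of "inv k" h] subgroupE(3)[OF ext(2)] by (simp add: exponent_carrier)

lemma generator_pow_mem: "x [^] (m::int) \<in> K"
  using ext(2) x by (rule subgroup_int_pow_closed)

text \<open>The condition \<open>a \<otimes> inv (x [^] m) \<in> H\<close> says that
  \<open>a\<close> and \<open>x [^] m\<close> agree modulo \<open>H\<close>. The quotient for the
  product is the quotient for \<open>a\<close> times the quotient for \<open>b\<close> conjugated by
  \<open>x [^] m\<close>.\<close>

lemma exponent_mult:
  assumes "a \<in> K" "b \<in> K" "a \<otimes> inv (x [^] (m::int)) \<in> H" "b \<otimes> inv (x [^] (n::int)) \<in> H"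
  shows "(a \<otimes> b) \<otimes> inv (x [^] (m + n)) \<in> H"
proof -
  note [simp] = exponent_carrier[OF assms(1)] exponent_carrier[OF assms(2)] exponent_carrier[OF x]
  have "(a \<otimes> inv (x [^] m)) \<otimes> (x [^] m \<otimes> (b \<otimes> inv (x [^] n)) \<otimes> inv (x [^] m)) \<in> H"
    using assms ext generator_pow_mem by (meson subgroup_def)
  also have "(a \<otimes> inv (x [^] m)) \<otimes> (x [^] m \<otimes> (b \<otimes> inv (x [^] n)) \<otimes> inv (x [^] m))
      = (a \<otimes> b) \<otimes> inv (x [^] (m + n))"
    by (simp add: int_pow_mult inv_mult_group m_assoc inv_mult_cancel)
  finally show ?thesis .
qed

lemma exponent_inv:
  assumes "a \<in> K" "a \<otimes> inv (x [^] (m::int)) \<in> H"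
  shows "inv a \<otimes> inv (x [^] (- m)) \<in> H"
proof -
  note [simp] = exponent_carrier[OF assms(1)] exponent_carrier[OF x]
  have "inv (x [^] m) \<otimes> inv (a \<otimes> inv (x [^] m)) \<otimes> x [^] m \<in> H"
    using exponent_conj[OF generator_pow_mem[of m]] assms(2) ext(1) by (simp add: subgroup_def)
  then show ?thesis
    by (simp add: int_pow_neg inv_mult_group m_assoc inv_mult_cancel)
qed

lemma exponent_pow:
  assumes "a \<in> K" "a \<otimes> inv (x [^] (m::int)) \<in> H"
  shows "a [^] (q::int) \<otimes> inv (x [^] (m * q)) \<in> H"
proof -
  have mem: "a [^] (q::int) \<in> K" for q
    using ext(2) assms(1) by (rule subgroup_int_pow_closed)
  have nat: "a [^] (int n) \<otimes> inv (x [^] (m * int n)) \<in> H" for n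
  proof (induction n)
    case 0
    then show ?case using ext(1) by (simp add: subgroup_def)
  next
    case (Suc n)
    have "a [^] (int (Suc n)) = a [^] (int n) \<otimes> a"
      using exponent_carrier[OF assms(1)] by (metis int_pow_int nat_pow_Suc)
    moreover have "m * int (Suc n) = m * int n + m" by (simp add: algebra_simps)
    ultimately show ?case using exponent_mult[OF mem assms(1) Suc assms(2)] by simp
  qed
  show ?thesis
  proof (cases "q \<ge> 0")
    case True
    then show ?thesis using nat[of "nat q"] by simp
  next
    case False
    then have "inv (a [^] (- q)) \<otimes> inv (x [^] (- (m * (- q)))) \<in> H"
      using exponent_inv[OF mem nat[of "nat (- q)"]] by simp
    then show ?thesis using exponent_carrier[OF assms(1)] by (simp add: int_pow_neg)
  qed
qed

end

section \<open>Chains of infinite index in cyclic extensions\<close>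

lemma cyclic_extensionD:
  assumes "cyclic_extension H K x"
  shows "subgroup H G" "subgroup K G" "H \<subseteq> K" "\<And>k h. k \<in> K \<Longrightarrow> h \<in> H \<Longrightarrow> k \<otimes> h \<otimes> inv k \<in> H"
    "x \<in> K" "\<And>k. k \<in> K \<Longrightarrow> \<exists>m::int. k \<otimes> inv (x [^] m) \<in> H"
  using assms unfolding cyclic_extension_def by blast+

text \<open>\<open>L / (H \<inter> L)\<close> embeds in the cyclic group \<open>K / H\<close>, and
  subgroups of cyclic groups are cyclic. If \<open>L\<close> is not inside \<open>H\<close>, the
  generator is an element of \<open>L\<close> of least positive exponent.\<close>

lemma cyclic_extension_subgroup:
  assumes ext: "cyclic_extension H K x" and L: "subgroup L G" "L \<subseteq> K"
  obtains y where "cyclic_extension (H \<inter> L) L y"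
proof (cases "L \<subseteq> H")
  case True
  have "cyclic_extension (H \<inter> L) L \<one>"
    using True L subgroup.subset[OF L(1)] subgroupE(3,4)[OF L(1)]
    unfolding cyclic_extension_def by (auto simp: Int_absorb1 subgroup.one_closed subset_iff)
  then show thesis by (rule that)
next
  case False
  note E = cyclic_extensionD[OF ext] and e = cyclic_extensionD(1-5)[OF ext]
  have LG: "a \<in> carrier G" if "a \<in> L" for a using L(1) that subgroup.subset by blast
  have xG: "x \<in> carrier G" using E(2,5) subgroup.subset by blast
  define P where "P m \<longleftrightarrow> 0 < m \<and> (\<exists>l\<in>L. l \<otimes> inv (x [^] int m) \<in> H)" for m :: nat
  obtain l where l: "l \<in> L" "l \<notin> H" using False by blast
  obtain m where m: "l \<otimes> inv (x [^] (m::int)) \<in> H" using E(6) l(1) L(2) by blast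
  have "m \<noteq> 0" using m l LG[OF l(1)] by (intro notI) simp
  then have "P (nat \<bar>m\<bar>)"
  proof (cases "m > 0")
    case True
    then show ?thesis using m l(1) unfolding P_def by (intro conjI bexI[of _ l]) auto
  next
    \<comment> \<open>For \<open>m < 0\<close> the inverse of \<open>l\<close> has the positive
      exponent \<open>- m\<close>.\<close>
    case False
    then show ?thesis
      using exponent_inv[OF e _ m] l(1) L subgroupE(3)[OF L(1)] \<open>m \<noteq> 0\<close>
      unfolding P_def by (intro conjI bexI[of _ "inv l"]) auto
  qed
  then have P: "P (LEAST m. P m)" by (rule LeastI)
  define m0 where "m0 = (LEAST m. P m)"
  obtain y where y: "0 < m0" "y \<in> L" "y \<otimes> inv (x [^] int m0) \<in> H"
    using P unfolding m0_def P_def by blast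
  have gen: "\<exists>q::int. a \<otimes> inv (y [^] q) \<in> H \<inter> L" if a: "a \<in> L" for a
  proof -
    obtain i where i: "a \<otimes> inv (x [^] (i::int)) \<in> H" using E(6) a L(2) by blast
    \<comment> \<open>Division with remainder: \<open>a \<otimes> inv (y [^] q)\<close> has exponent
      \<open>r < m0\<close>, and minimality of \<open>m0\<close> forces
      \<open>r = 0\<close>.\<close>
    define q r where "q = i div int m0" and "r = i mod int m0"
    have qL: "y [^] q \<in> L" "inv (y [^] q) \<in> L"
      using subgroup_int_pow_closed[OF L(1) y(2)] subgroupE(3)[OF L(1)] by blast+
    have bL: "a \<otimes> inv (y [^] q) \<in> L" using qL a subgroupE(4)[OF L(1)] by blast
    have "inv (y [^] q) \<otimes> inv (x [^] (- (int m0 * q))) \<in> H"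
      using exponent_inv[OF e _ exponent_pow[OF e _ y(3)]] y(2) L(2) qL by blast
    then have "(a \<otimes> inv (y [^] q)) \<otimes> inv (x [^] (i + - (int m0 * q))) \<in> H"
      using exponent_mult[OF e _ _ i] a L(2) qL by blast
    moreover have "i + - (int m0 * q) = r" by (simp add: q_def r_def minus_mult_div_eq_mod)
    ultimately have r: "(a \<otimes> inv (y [^] q)) \<otimes> inv (x [^] r) \<in> H" by simp
    have "r = 0"
    proof (rule ccontr)
      assume "r \<noteq> 0"
      then have r0: "0 < r" "r < int m0" using y(1) pos_mod_sign[of "int m0" i] pos_mod_bound[of "int m0" i]
        unfolding r_def by linarith+
      then have "P (nat r)" using r bL unfolding P_def by auto
      then have "m0 \<le> nat r" unfolding m0_def by (rule Least_le)
      then show False using r0 by simp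
    qed
    then have "a \<otimes> inv (y [^] q) \<in> H" using r LG[OF bL] by simp
    then show ?thesis using bL by blast
  qed
  have "cyclic_extension (H \<inter> L) L y"
    unfolding cyclic_extension_def
  proof (intro conjI ballI)
    fix k assume k: "k \<in> L"
    then show "\<exists>q::int. k \<otimes> inv (y [^] q) \<in> H \<inter> L" by (rule gen)
    fix h assume h: "h \<in> H \<inter> L"
    have "k \<otimes> h \<otimes> inv k \<in> H" using E(4)[of k h] k h L(2) by blast
    moreover have "k \<otimes> h \<otimes> inv k \<in> L" using k h L(1) by (simp add: subgroup_def)
    ultimately show "k \<otimes> h \<otimes> inv k \<in> H \<inter> L" ..
  next
    show "subgroup (H \<inter> L) G" using E(1) L(1) by (rule subgroups_Inter_pair)
  qed (simp_all add: L(1) y(2))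
  then show thesis by (rule that)
qed

text \<open>Some \<open>l\<close> in \<open>L\<close> has a nonzero exponent \<open>m\<close>, so a
  power of \<open>l\<close> reduces the exponent of any element of \<open>K\<close> to a remainder
  modulo \<open>m\<close>. What then remains in \<open>H\<close> is covered by the finite index of
  \<open>H \<inter> L\<close> in \<open>H\<close>.\<close>

lemma cyclic_extension_finite_index:
  assumes ext: "cyclic_extension H K x" and L: "subgroup L G" "L \<subseteq> K" "\<not> L \<subseteq> H"
    and fin: "finite_index (H \<inter> L) H"
  shows "finite_index L K"
proof -
  note E = cyclic_extensionD[OF ext] and e = cyclic_extensionD(1-5)[OF ext]
  have KG: "a \<in> carrier G" if "a \<in> K" for a using E(2) that subgroup.subset by blast
  obtain l where l: "l \<in> L" "l \<notin> H" using L by blast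
  obtain m where m: "l \<otimes> inv (x [^] (m::int)) \<in> H" using E(6) l(1) L(2) by blast
  have "m \<noteq> 0" using m l KG L by (intro notI) auto
  obtain F where F: "finite F" "F \<subseteq> H" "\<And>h. h \<in> H \<Longrightarrow> \<exists>f\<in>F. h \<otimes> inv f \<in> H \<inter> L"
    using finite_index_transversal[OF subgroups_Inter_pair[OF E(1) L(1)] _ fin]
      subgroup.subset[OF E(1)] by blast
  define R where "R = (\<lambda>(f, r). f \<otimes> x [^] (r::int)) ` (F \<times> {- \<bar>m\<bar>..\<bar>m\<bar>})"
  show ?thesis
  proof (rule finite_indexI)
    show "finite R" using F(1) by (simp add: R_def)
    show "R \<subseteq> carrier G" using F(2) E(3,5) KG by (auto simp: R_def subset_iff)
    fix k assume k: "k \<in> K"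
    obtain i where i: "k \<otimes> inv (x [^] (i::int)) \<in> H" using E(6) k by blast
    define q r where "q = i div m" and "r = i mod m"
    have qL: "l [^] q \<in> L" "inv (l [^] q) \<in> L"
      using subgroup_int_pow_closed[OF L(1) l(1)] subgroupE(3)[OF L(1)] by blast+
    have "inv (l [^] q) \<otimes> inv (x [^] (- (m * q))) \<in> H"
      using exponent_inv[OF e _ exponent_pow[OF e _ m]] l(1) L(2) qL by blast
    then have "(inv (l [^] q) \<otimes> k) \<otimes> inv (x [^] (- (m * q) + i)) \<in> H"
      using exponent_mult[OF e _ k _ i] L(2) qL by blast
    moreover have "- (m * q) + i = r" using minus_mult_div_eq_mod[of i m] by (simp add: q_def r_def)
    ultimately have "(inv (l [^] q) \<otimes> k) \<otimes> inv (x [^] r) \<in> H" by simp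
    then obtain f where f: "f \<in> F" "(inv (l [^] q) \<otimes> k) \<otimes> inv (x [^] r) \<otimes> inv f \<in> L"
      using F(3) by blast
    have c: "l \<in> carrier G" "k \<in> carrier G" "x \<in> carrier G" "f \<in> carrier G"
      using KG k E(3,5) l L(2) f(1) F(2) by auto
    have "l [^] q \<otimes> ((inv (l [^] q) \<otimes> k) \<otimes> inv (x [^] r) \<otimes> inv f) \<in> L"
      using f(2) qL subgroupE(4)[OF L(1)] by blast
    also have "l [^] q \<otimes> ((inv (l [^] q) \<otimes> k) \<otimes> inv (x [^] r) \<otimes> inv f) = k \<otimes> inv (f \<otimes> x [^] r)"
      using c by (simp add: m_assoc inv_mult_group inv_mult_cancel)
    finally have "k \<otimes> inv (f \<otimes> x [^] r) \<in> L" .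
    moreover have "\<bar>r\<bar> \<le> \<bar>m\<bar>"
      using \<open>m \<noteq> 0\<close> abs_mod_less[of m i] by (simp add: r_def)
    then have "f \<otimes> x [^] r \<in> R"
      using f(1) unfolding R_def by (intro image_eqI[of _ _ "(f, r)"]) auto
    ultimately show "\<exists>z\<in>R. k \<otimes> inv z \<in> L" by blast
  qed
qed

text \<open>Passing from \<open>K\<close> to \<open>H\<close> costs at most one step. For the first
  member \<open>L\<close> of the chain, either \<open>H \<inter> L\<close> has infinite index in
  \<open>H\<close> and induction applies to the cyclic extension from \<open>H \<inter> L\<close> to
  \<open>L\<close>, or \<open>cyclic_extension_finite_index\<close> forces
  \<open>L \<subseteq> H\<close> and the rest of the chain already lies in \<open>H\<close>.\<close>

lemma infinite_index_chain_cyclic_extension: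
  assumes "cyclic_extension H K x" "infinite_index_chain (Suc n) K"
  shows "infinite_index_chain n H"
  using assms
proof (induction n arbitrary: H K x)
  case (Suc n)
  note ext = Suc.prems(1)
  from Suc.prems(2) obtain L where L: "subgroup L G" "L \<subseteq> K" "\<not> finite_index L K"
    "infinite_index_chain (Suc n) L"
    by (metis infinite_index_chain.simps(2))
  show ?case
  proof (cases "finite_index (H \<inter> L) H")
    case True
    then have "L \<subseteq> H" using cyclic_extension_finite_index[OF ext L(1,2)] L(3) by blast
    then show ?thesis using L(4) infinite_index_chain_mono by blast
  next
    case False
    obtain y where "cyclic_extension (H \<inter> L) L y"
      using cyclic_extension_subgroup[OF ext L(1,2)] .
    then have "infinite_index_chain n (H \<inter> L)" using Suc.IH L(4) by blast
    moreover have "subgroup (H \<inter> L) G"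
      using cyclic_extensionD(1)[OF ext] L(1) by (rule subgroups_Inter_pair)
    ultimately show ?thesis using False by auto
  qed
qed simp

text \<open>If the index is infinite, putting \<open>H\<close> itself in front of a chain of
  \<open>H\<close> gives the lower bound, and \<open>infinite_index_chain_cyclic_extension\<close>
  gives the upper one.\<close>

lemma infinite_index_chain_cyclic_extension_iff:
  assumes ext: "cyclic_extension H K x" and H: "\<And>n. infinite_index_chain n H \<longleftrightarrow> n \<le> d"
  shows "infinite_index_chain n K \<longleftrightarrow> n \<le> (if finite_index H K then d else Suc d)"
proof (cases "finite_index H K")
  case True
  then have "infinite_index_chain n K \<longleftrightarrow> infinite_index_chain n H"
    using infinite_index_chain_finite_index infinite_index_chain_mono cyclic_extensionD(1-3)[OF ext]
    by blast
  then show ?thesis using True H by simp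
next
  case False
  show ?thesis
  proof (cases n)
    case (Suc m)
    have "infinite_index_chain (Suc m) K" if "infinite_index_chain m H"
      using that False cyclic_extensionD(1,3)[OF ext] by auto
    then show ?thesis
      using infinite_index_chain_cyclic_extension[OF ext] H False Suc by auto
  qed simp
qed

text \<open>The form \<open>n \<le> 0\<close> fits the hypothesis of
  \<open>infinite_index_chain_cyclic_extension_iff\<close> with \<open>d = 0\<close>.\<close>

lemma infinite_index_chain_trivial: "infinite_index_chain n {\<one>} \<longleftrightarrow> n \<le> 0"
proof (cases n)
  case (Suc m)
  have "finite_index H {\<one>}" if "subgroup H G" for H
    using that by (intro finite_indexI[of "{\<one>}"]) (auto simp: subgroup.one_closed)
  then show ?thesis using Suc by auto
qed simp

section \<open>Polycyclic subgroups\<close>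

text \<open>The inductive form gives induction along a series; an indexed series is recovered in
  \<open>polycyclic_cyclic_subnormal_series\<close>.\<close>

inductive polycyclic :: "'a set \<Rightarrow> bool" where
  trivial: "polycyclic {\<one>}"
| extension: "polycyclic H \<Longrightarrow> cyclic_extension H K x \<Longrightarrow> polycyclic K"

lemma polycyclic_subgroup: "polycyclic K \<Longrightarrow> subgroup K G"
  by (induction rule: polycyclic.induct) (simp_all add: triv_subgroup cyclic_extension_def)

lemma polycyclic_infinite_index_chain:
  assumes "polycyclic K"
  obtains d where "\<And>n. infinite_index_chain n K \<longleftrightarrow> n \<le> d"
proof -
  from assms have "\<exists>d. \<forall>n. infinite_index_chain n K \<longleftrightarrow> n \<le> d"
  proof (induction rule: polycyclic.induct)
    case trivial
    then show ?case using infinite_index_chain_trivial by blast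
  next
    case (extension H K x)
    then show ?case using infinite_index_chain_cyclic_extension_iff by meson
  qed
  then show thesis using that by blast
qed

text \<open>Finitely many generators of \<open>H \<inter> L\<close>, which exist by induction,
  together with a generator \<open>y\<close> of \<open>L\<close> modulo \<open>H \<inter> L\<close>
  generate \<open>L\<close>.\<close>

lemma polycyclic_noetherian:
  assumes "polycyclic K" "subgroup L G" "L \<subseteq> K"
  shows "\<exists>S. finite S \<and> S \<subseteq> L \<and> generate G S = L"
  using assms
proof (induction arbitrary: L rule: polycyclic.induct)
  case trivial
  then have "L = {\<one>}" using subgroup.one_closed by blast
  then show ?case using generate_empty by (intro exI[of _ "{}"]) auto
next
  case (extension H K x)
  obtain y where y: "cyclic_extension (H \<inter> L) L y"
    using cyclic_extension_subgroup extension by blast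
  note E = cyclic_extensionD[OF y]
  obtain S where S: "finite S" "S \<subseteq> H \<inter> L" "generate G S = H \<inter> L"
    using extension.IH[OF E(1)] by blast
  have LG: "L \<subseteq> carrier G" using extension(4) subgroup.subset by blast
  have "L \<subseteq> generate G (insert y S)"
  proof
    fix a assume a: "a \<in> L"
    obtain m where m: "a \<otimes> inv (y [^] (m::int)) \<in> H \<inter> L" using E(6) a by blast
    have sg: "subgroup (generate G (insert y S)) G"
      using E(5) S(2) LG by (intro generate_is_subgroup) auto
    have "a \<otimes> inv (y [^] m) \<in> generate G (insert y S)"
      using m S(3) mono_generate[of S "insert y S"] by auto
    moreover have "y [^] m \<in> generate G (insert y S)"
      using subgroup_int_pow_closed[OF sg] generate.incl[of y] by blast
    ultimately have "a \<otimes> inv (y [^] m) \<otimes> y [^] m \<in> generate G (insert y S)"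
      using subgroupE(4)[OF sg] by blast
    then show "a \<in> generate G (insert y S)"
      using a E(5) LG by (simp add: m_assoc subset_iff)
  qed
  moreover have "generate G (insert y S) \<subseteq> L"
    using E(5) S(2) by (intro generate_subgroup_incl[OF _ extension(4)]) auto
  ultimately show ?case using S E(5) by (intro exI[of _ "insert y S"]) auto
qed

section \<open>Commutators and the lower central series\<close>

abbreviation commutator :: "'a \<Rightarrow> 'a \<Rightarrow> 'a" where
  "commutator x y \<equiv> x \<otimes> y \<otimes> inv x \<otimes> inv y"

lemma inv_commutator:
  assumes "x \<in> carrier G" "y \<in> carrier G"
  shows "inv (commutator x y) = commutator y x"
  using assms by (simp add: inv_mult_group m_assoc)

text \<open>The conjugate \<open>g \<otimes> a \<otimes> inv g\<close> equals
  \<open>inv (commutator a g) \<otimes> a\<close>.\<close>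

lemma normal_if_commutator:
  assumes "subgroup A G" "\<And>a g. a \<in> A \<Longrightarrow> g \<in> carrier G \<Longrightarrow> commutator a g \<in> A"
  shows "A \<lhd> G"
proof (rule normal_invI[OF assms(1)])
  fix g a assume g: "g \<in> carrier G" "a \<in> A"
  then have a: "a \<in> carrier G" using assms(1) by (simp add: subgroup.mem_carrier)
  have "inv (commutator a g) \<otimes> a \<in> A"
    using assms(2)[of a g] g assms(1) by (simp add: subgroup_def)
  then show "g \<otimes> a \<otimes> inv g \<in> A"
    using g a by (simp add: inv_mult_group m_assoc)
qed

lemma normal_commutator:
  assumes "D \<lhd> G" "d \<in> D" "g \<in> carrier G"
  shows "commutator d g \<in> D" "commutator g d \<in> D"
proof -
  note D = normal_imp_subgroup[OF assms(1)]
  have d: "d \<in> carrier G" "inv d \<in> D" using D assms(2) by (simp_all add: subgroup_def subset_iff)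
  have "d \<otimes> (g \<otimes> inv d \<otimes> inv g) \<in> D"
    using assms d D normal_invE(2)[OF assms(1,3)] by (simp add: subgroup_def)
  then show *: "commutator d g \<in> D" using d(1) assms(3) by (simp add: m_assoc)
  show "commutator g d \<in> D"
    using * D inv_commutator[OF d(1) assms(3)] by (metis subgroup_def)
qed

text \<open>This is the preimage of the centralizer of a coset in \<open>G / D\<close>. Being a
  subgroup, it lets commutator conditions be checked on generators only.\<close>

lemma subgroup_centralizer_mod:
  assumes "D \<lhd> G" "x \<in> carrier G"
  shows "subgroup {y \<in> carrier G. commutator x y \<in> D} G"
proof (rule subgroupI)
  note D = normal_imp_subgroup[OF assms(1)] and n = normal_invE(2)[OF assms(1)]
  show "{y \<in> carrier G. commutator x y \<in> D} \<noteq> {}"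
    using assms(2) subgroup.one_closed[OF D] by (intro notI) (auto dest: bspec[of _ _ \<one>])
  fix a assume a: "a \<in> {y \<in> carrier G. commutator x y \<in> D}"
  have "inv a \<otimes> inv (commutator x a) \<otimes> inv (inv a) \<in> D"
    using a D by (intro n) (auto simp: subgroup_def)
  then show "inv a \<in> {y \<in> carrier G. commutator x y \<in> D}"
    using a assms(2) by (simp add: inv_mult_group m_assoc inv_mult_cancel)
  fix b assume b: "b \<in> {y \<in> carrier G. commutator x y \<in> D}"
  have "commutator x a \<otimes> (a \<otimes> commutator x b \<otimes> inv a) \<in> D"
    using a b D n by (simp add: subgroup_def)
  then show "a \<otimes> b \<in> {y \<in> carrier G. commutator x y \<in> D}"
    using a b assms(2) by (simp add: inv_mult_group m_assoc inv_mult_cancel)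
qed (use assms in auto)

lemma subgroup_centralizer_mod':
  assumes "D \<lhd> G" "x \<in> carrier G"
  shows "subgroup {y \<in> carrier G. commutator y x \<in> D} G"
proof -
  note D = normal_imp_subgroup[OF assms(1)]
  have "commutator y x \<in> D \<longleftrightarrow> commutator x y \<in> D" if "y \<in> carrier G" for y
    using that assms(2) D inv_commutator by (metis subgroup_def)
  then have "{y \<in> carrier G. commutator y x \<in> D} = {y \<in> carrier G. commutator x y \<in> D}"
    by blast
  then show ?thesis using subgroup_centralizer_mod[OF assms] by simp
qed

section \<open>Adjoining one element to a normal subgroup\<close>

text \<open>For normal \<open>H\<close> this is the subgroup generated by \<open>H\<close> and
  \<open>x\<close>, written so that the cyclic extension can be read off.\<close>

definition adjoin :: "'a set \<Rightarrow> 'a \<Rightarrow> 'a set" where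
  "adjoin H x = {k \<in> carrier G. \<exists>m::int. k \<otimes> inv (x [^] m) \<in> H}"

lemma adjoin:
  assumes "H \<lhd> G" "x \<in> carrier G"
  shows "subgroup (adjoin H x) G" "H \<subseteq> adjoin H x" "x \<in> adjoin H x"
    and "cyclic_extension H (adjoin H x) x"
proof -
  note H = normal_imp_subgroup[OF assms(1)] and n = normal_invE(2)[OF assms(1)]
  note e = H subgroup_self subgroup.subset[OF H] n assms(2)
  show sub: "H \<subseteq> adjoin H x"
    using subgroup.mem_carrier[OF H] by (auto simp: adjoin_def intro: exI[of _ 0])
  show x: "x \<in> adjoin H x"
    using assms(2) subgroup.one_closed[OF H] by (auto simp: adjoin_def intro: exI[of _ 1])
  show sg: "subgroup (adjoin H x) G"
  proof (rule subgroupI)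
    fix a assume "a \<in> adjoin H x"
    then obtain m where a: "a \<in> carrier G" "a \<otimes> inv (x [^] (m::int)) \<in> H"
      by (auto simp: adjoin_def)
    have "inv a \<otimes> inv (x [^] (- m)) \<in> H" using e a by (rule exponent_inv)
    then show "inv a \<in> adjoin H x" using a unfolding adjoin_def by blast
    fix b assume "b \<in> adjoin H x"
    then obtain k where b: "b \<in> carrier G" "b \<otimes> inv (x [^] (k::int)) \<in> H"
      by (auto simp: adjoin_def)
    have "a \<otimes> b \<otimes> inv (x [^] (m + k)) \<in> H"
      using e a(1) b(1) a(2) b(2) by (rule exponent_mult)
    then show "a \<otimes> b \<in> adjoin H x" using a b unfolding adjoin_def by blast
  qed (use x in \<open>auto simp: adjoin_def\<close>)
  show "cyclic_extension H (adjoin H x) x"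
    unfolding cyclic_extension_def
  proof (intro conjI ballI)
    fix k h assume "k \<in> adjoin H x" "h \<in> H"
    then show "k \<otimes> h \<otimes> inv k \<in> H" using n by (simp add: adjoin_def)
  qed (use H sg sub x in \<open>simp_all add: adjoin_def\<close>)
qed

lemma adjoin_least:
  assumes "subgroup A G" "H \<subseteq> A" "x \<in> A"
  shows "adjoin H x \<subseteq> A"
proof
  fix k assume "k \<in> adjoin H x"
  then obtain m where k: "k \<in> carrier G" "k \<otimes> inv (x [^] (m::int)) \<in> H"
    by (auto simp: adjoin_def)
  have "x [^] m \<in> A" using assms(1,3) by (rule subgroup_int_pow_closed)
  then have "k \<otimes> inv (x [^] m) \<otimes> x [^] m \<in> A"
    using k(2) assms(1,2) subgroupE(4)[OF assms(1)] by blast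
  then show "k \<in> A"
    using k(1) subgroup.mem_carrier[OF assms(1,3)] by (simp add: m_assoc)
qed

text \<open>The elements that commute with \<open>g\<close> modulo \<open>H\<close> form a subgroup
  containing \<open>H\<close> and \<open>x\<close>, so all of \<open>adjoin H x\<close> is central
  modulo \<open>H\<close>.\<close>

lemma adjoin_normal:
  assumes "H \<lhd> G" "x \<in> carrier G" "\<And>g. g \<in> carrier G \<Longrightarrow> commutator x g \<in> H"
  shows "adjoin H x \<lhd> G"
proof (rule normal_if_commutator[OF adjoin(1)[OF assms(1,2)]])
  fix a g assume a: "a \<in> adjoin H x" and g: "g \<in> carrier G"
  have "adjoin H x \<subseteq> {y \<in> carrier G. commutator y g \<in> H}"
    using normal_imp_subgroup[OF assms(1)] normal_commutator(1)[OF assms(1) _ g] assms g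
    by (intro adjoin_least subgroup_centralizer_mod') (auto simp: subgroup.mem_carrier)
  then show "commutator a g \<in> adjoin H x"
    using a adjoin(2)[OF assms(1,2)] by blast
qed

section \<open>The lower central series\<close>

abbreviation \<gamma> :: "nat \<Rightarrow> 'a set" where
  "\<gamma> \<equiv> lower_central_series G"

lemma lower_central_series_carrier: "\<gamma> n \<subseteq> carrier G"
proof (induction n)
  case (Suc n)
  then show ?case
    unfolding lower_central_series.simps
    by (intro generate_incl) (auto simp: subset_iff)
qed simp

lemma lower_central_series_subgroup: "subgroup (\<gamma> n) G"
proof (cases n)
  case (Suc m)
  then show ?thesis
    using lower_central_series_carrier[of m]
    unfolding Suc lower_central_series.simps
    by (intro generate_is_subgroup) (auto simp: subset_iff)
qed (simp add: subgroup_self)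

lemma lower_central_series_commutator:
  assumes "x \<in> \<gamma> n" "y \<in> carrier G"
  shows "commutator x y \<in> \<gamma> (Suc n)"
  unfolding lower_central_series.simps using assms by (intro generate.incl) blast

lemma lower_central_series_least:
  assumes "subgroup D G" "\<And>x y. x \<in> \<gamma> n \<Longrightarrow> y \<in> carrier G \<Longrightarrow> commutator x y \<in> D"
  shows "\<gamma> (Suc n) \<subseteq> D"
  unfolding lower_central_series.simps using assms by (intro generate_subgroup_incl) blast+

lemma lower_central_series_Suc_subset: "\<gamma> (Suc n) \<subseteq> \<gamma> n"
proof (induction n)
  case (Suc n)
  show ?case
  proof (rule lower_central_series_least[OF lower_central_series_subgroup])
    fix x y assume "x \<in> \<gamma> (Suc n)" "y \<in> carrier G"
    then show "commutator x y \<in> \<gamma> (Suc n)"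
      using Suc by (intro lower_central_series_commutator) blast
  qed
qed (simp only: lower_central_series.simps(1) lower_central_series_carrier)

text \<open>The factor \<open>\<gamma> n / \<gamma> (Suc n)\<close> is central in
  \<open>G / \<gamma> (Suc n)\<close>. Hence elements of \<open>\<gamma> n\<close> can be adjoined
  one at a time without losing normality.\<close>

lemma lower_central_series_normal_between:
  assumes "subgroup A G" "\<gamma> (Suc n) \<subseteq> A" "A \<subseteq> \<gamma> n"
  shows "A \<lhd> G"
proof (rule normal_if_commutator[OF assms(1)])
  fix a g assume "a \<in> A" "g \<in> carrier G"
  then have "commutator a g \<in> \<gamma> (Suc n)"
    using assms(3) by (intro lower_central_series_commutator) blast
  then show "commutator a g \<in> A" using assms(2) by blast
qed

text \<open>Modulo \<open>\<gamma> (Suc (Suc n))\<close>, the group \<open>\<gamma> (Suc n)\<close>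
  is generated by the commutators of generators of \<open>\<gamma> n\<close> modulo
  \<open>\<gamma> (Suc n)\<close> with generators of \<open>G\<close>.\<close>

lemma lower_central_series_finitely_generated:
  assumes "finitely_generated G"
  shows "\<exists>X. finite X \<and> X \<subseteq> \<gamma> n \<and> generate G (X \<union> \<gamma> (Suc n)) = \<gamma> n"
proof (induction n)
  case 0
  obtain S where S: "S \<subseteq> carrier G" "finite S" "generate G S = carrier G"
    using assms unfolding finitely_generated_def by blast
  have "generate G (S \<union> \<gamma> (Suc 0)) = carrier G"
    using mono_generate[of S "S \<union> \<gamma> (Suc 0)"] S(1,3) lower_central_series_carrier[of "Suc 0"]
      generate_incl[of "S \<union> \<gamma> (Suc 0)"] by blast
  then show ?case using S by (intro exI[of _ S]) simp
next
  case (Suc n)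
  obtain X where X: "finite X" "X \<subseteq> \<gamma> n" "generate G (X \<union> \<gamma> (Suc n)) = \<gamma> n"
    using Suc by blast
  obtain S where S: "S \<subseteq> carrier G" "finite S" "generate G S = carrier G"
    using assms unfolding finitely_generated_def by blast
  define Y where "Y = (\<lambda>(x, s). commutator x s) ` (X \<times> S)"
  define D where "D = generate G (Y \<union> \<gamma> (Suc (Suc n)))"
  have XG: "X \<subseteq> carrier G" using X(2) lower_central_series_carrier by blast
  have Y: "Y \<subseteq> \<gamma> (Suc n)"
  proof -
    have "commutator x s \<in> \<gamma> (Suc n)" if "x \<in> X" "s \<in> S" for x s
      using that X(2) S(1) by (intro lower_central_series_commutator) blast+
    then show ?thesis unfolding Y_def by fast
  qed
  have YD: "Y \<subseteq> D" "\<gamma> (Suc (Suc n)) \<subseteq> D"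
    unfolding D_def by (auto intro: generate.incl)
  have D_sub: "D \<subseteq> \<gamma> (Suc n)"
    unfolding D_def using Y lower_central_series_Suc_subset
    by (intro generate_subgroup_incl lower_central_series_subgroup) blast
  have D_sg: "subgroup D G"
    unfolding D_def using Y lower_central_series_carrier by (intro generate_is_subgroup) blast
  have D: "D \<lhd> G"
    using D_sg YD(2) D_sub by (rule lower_central_series_normal_between)
  \<comment> \<open>The second argument is extended first, from \<open>S\<close> to all of
    \<open>G\<close>, with the first one still in \<open>X\<close>.\<close>
  have gen: "commutator x y \<in> D" if x: "x \<in> X" and y: "y \<in> carrier G" for x y
  proof -
    have "generate G S \<subseteq> {y \<in> carrier G. commutator x y \<in> D}"
    proof (rule generate_subgroup_incl)
      show "subgroup {y \<in> carrier G. commutator x y \<in> D} G"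
        using D x XG by (intro subgroup_centralizer_mod) (blast, blast)
      have "commutator x s \<in> D" if "s \<in> S" for s
        using YD(1) x that unfolding Y_def by fast
      then show "S \<subseteq> {y \<in> carrier G. commutator x y \<in> D}" using S(1) by blast
    qed
    then show ?thesis using S(3) y by blast
  qed
  have "\<gamma> (Suc n) \<subseteq> D"
  proof (rule lower_central_series_least[OF D_sg])
    fix x y assume x: "x \<in> \<gamma> n" and y: "y \<in> carrier G"
    \<comment> \<open>Now the first argument is extended from \<open>X\<close> to
      \<open>\<gamma> n\<close>. Elements of \<open>\<gamma> (Suc n)\<close> are harmless, as their
      commutators lie in \<open>\<gamma> (Suc (Suc n))\<close>.\<close>
    have "generate G (X \<union> \<gamma> (Suc n)) \<subseteq> {x \<in> carrier G. commutator x y \<in> D}"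
    proof (rule generate_subgroup_incl)
      show "subgroup {x \<in> carrier G. commutator x y \<in> D} G"
        using D y by (rule subgroup_centralizer_mod')
      have "commutator a y \<in> D" if "a \<in> \<gamma> (Suc n)" for a
        using lower_central_series_commutator[OF that y] YD(2) by blast
      then show "X \<union> \<gamma> (Suc n) \<subseteq> {x \<in> carrier G. commutator x y \<in> D}"
        using XG lower_central_series_carrier[of "Suc n"] gen[OF _ y] by blast
    qed
    then show "commutator x y \<in> D" using X(3) x by blast
  qed
  then have "D = \<gamma> (Suc n)" using D_sub by blast
  then show ?case using Y X(1) S(2) unfolding D_def by (intro exI[of _ Y]) (simp add: Y_def)
qed

text \<open>From the trivial term up to \<open>\<gamma> 0\<close>, each term arises from the next
  one by adjoining finitely many elements, and each adjunction is a cyclic extension.\<close>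

lemma nilpotent_polycyclic:
  assumes "finitely_generated G" "nilpotent G"
  shows "polycyclic (carrier G)"
proof -
  have step: "polycyclic (\<gamma> n)" if p: "polycyclic (\<gamma> (Suc n))" for n
  proof -
    obtain X where X: "finite X" "X \<subseteq> \<gamma> n" "generate G (X \<union> \<gamma> (Suc n)) = \<gamma> n"
      using lower_central_series_finitely_generated[OF assms(1)] by blast
    from X(1,2) have "\<exists>P. polycyclic P \<and> X \<union> \<gamma> (Suc n) \<subseteq> P \<and> P \<subseteq> \<gamma> n"
    proof (induction rule: finite_induct)
      case empty
      then show ?case using p lower_central_series_Suc_subset by blast
    next
      case (insert x X)
      then obtain P where P: "polycyclic P" "X \<union> \<gamma> (Suc n) \<subseteq> P" "P \<subseteq> \<gamma> n" by blast
      have "P \<lhd> G"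
        using P polycyclic_subgroup[OF P(1)] by (intro lower_central_series_normal_between) auto
      moreover have x: "x \<in> \<gamma> n" "x \<in> carrier G"
        using insert lower_central_series_carrier by blast+
      ultimately have "P \<subseteq> adjoin P x" "x \<in> adjoin P x" "polycyclic (adjoin P x)"
        using adjoin polycyclic.extension[OF P(1)] by metis+
      moreover have "adjoin P x \<subseteq> \<gamma> n"
        using lower_central_series_subgroup P(3) x(1) by (rule adjoin_least)
      ultimately show ?case using P(2) by blast
    qed
    then obtain P where P: "polycyclic P" "X \<union> \<gamma> (Suc n) \<subseteq> P" "P \<subseteq> \<gamma> n" by blast
    have "\<gamma> n \<subseteq> P"
      using generate_subgroup_incl[OF P(2) polycyclic_subgroup[OF P(1)]] X(3) by blast
    then show ?thesis using P by (simp add: subset_antisym)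
  qed
  obtain c where c: "\<gamma> c = {\<one>}" using assms(2) unfolding nilpotent_def by blast
  have "polycyclic (\<gamma> 0)"
    by (rule inc_induct[of 0 c]) (use c polycyclic.trivial step in auto)
  then show ?thesis by simp
qed

section \<open>Central elements of infinite order\<close>

lemma r_coset_eq_iff:
  assumes "subgroup H G" "x \<in> carrier G" "y \<in> carrier G"
  shows "H #> x = H #> y \<longleftrightarrow> x \<otimes> inv y \<in> H"
  using assms repr_independence[of x H y] rcos_self[of x H] subgroup.rcos_module[OF assms(1) group_axioms]
  by metis

lemma finite_index_iff_finite_cosets:
  assumes "subgroup H G" "K \<subseteq> carrier G"
  shows "finite_index H K \<longleftrightarrow> finite ((\<lambda>k. H #> k) ` K)"
proof
  assume "finite_index H K"
  then obtain F where F: "finite F" "F \<subseteq> K" "\<And>k. k \<in> K \<Longrightarrow> \<exists>f\<in>F. k \<otimes> inv f \<in> H"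
    using finite_index_transversal[OF assms] by metis
  have "(\<lambda>k. H #> k) ` K \<subseteq> (\<lambda>k. H #> k) ` F"
  proof
    fix X assume "X \<in> (\<lambda>k. H #> k) ` K"
    then obtain k where k: "k \<in> K" "X = H #> k" by blast
    obtain f where f: "f \<in> F" "k \<otimes> inv f \<in> H" using F(3) k(1) by blast
    then have "H #> k = H #> f"
      using k(1) F(2) assms r_coset_eq_iff by blast
    then show "X \<in> (\<lambda>k. H #> k) ` F" using f(1) k(2) by blast
  qed
  then show "finite ((\<lambda>k. H #> k) ` K)" using F(1) finite_surj by blast
next
  assume "finite ((\<lambda>k. H #> k) ` K)"
  then obtain F where F: "F \<subseteq> K" "finite F" "(\<lambda>k. H #> k) ` K = (\<lambda>k. H #> k) ` F"
    using finite_subset_image[of "(\<lambda>k. H #> k) ` K" "\<lambda>k. H #> k" K] by blast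
  show "finite_index H K"
  proof (rule finite_indexI[OF F(2)])
    show "F \<subseteq> carrier G" using F(1) assms(2) by blast
    fix k assume k: "k \<in> K"
    then obtain f where f: "f \<in> F" "H #> k = H #> f" using F(3) by blast
    then have "k \<otimes> inv f \<in> H"
      using k F(1) assms r_coset_eq_iff by blast
    then show "\<exists>f\<in>F. k \<otimes> inv f \<in> H" using f(1) by blast
  qed
qed

lemma normal_set_mult:
  assumes "M \<lhd> G" "N \<lhd> G"
  shows "M <#> N \<lhd> G" "M \<subseteq> M <#> N" "N \<subseteq> M <#> N"
proof -
  note M = normal_imp_subgroup[OF assms(1)] and N = normal_imp_subgroup[OF assms(2)]
  show "M <#> N \<lhd> G"
  proof (rule normal_invI)
    show "subgroup (M <#> N) G" using assms(1) N by (rule mult_norm_subgroup)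
    fix g h assume g: "g \<in> carrier G" and "h \<in> M <#> N"
    then obtain a b where ab: "a \<in> M" "b \<in> N" "h = a \<otimes> b" unfolding set_mult_def by blast
    then have c: "a \<in> carrier G" "b \<in> carrier G" using M N subgroup.subset by blast+
    have "g \<otimes> h \<otimes> inv g = (g \<otimes> a \<otimes> inv g) \<otimes> (g \<otimes> b \<otimes> inv g)"
      using g c ab(3) by (simp add: m_assoc inv_mult_cancel)
    moreover have "g \<otimes> a \<otimes> inv g \<in> M" "g \<otimes> b \<otimes> inv g \<in> N"
      using normal_invE(2) assms g ab by metis+
    ultimately show "g \<otimes> h \<otimes> inv g \<in> M <#> N" unfolding set_mult_def by blast
  qed
  have "a \<in> M <#> N" if "a \<in> M" for a
    using that subgroup.one_closed[OF N] subgroup.mem_carrier[OF M that]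
    unfolding set_mult_def by force
  then show "M \<subseteq> M <#> N" by blast
  have "b \<in> M <#> N" if "b \<in> N" for b
    using that subgroup.one_closed[OF M] subgroup.mem_carrier[OF N that]
    unfolding set_mult_def by force
  then show "N \<subseteq> M <#> N" by blast
qed

text \<open>Since \<open>A \<subseteq> M\<close>, representatives of \<open>N\<close> modulo
  \<open>A\<close> also represent \<open>M <#> N\<close> modulo \<open>M\<close>; transitivity
  through \<open>M\<close> does the rest.\<close>

lemma finite_index_set_mult:
  assumes "subgroup M G" "subgroup N G" "finite_index A M" "finite_index A N" "A \<subseteq> M"
  shows "finite_index A (M <#> N)"
proof -
  obtain F where F: "finite F" "F \<subseteq> carrier G" "\<forall>b\<in>N. \<exists>f\<in>F. b \<otimes> inv f \<in> A"
    using assms(4) unfolding finite_index_def by blast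
  have "finite_index M (M <#> N)"
  proof (rule finite_indexI[OF F(1,2)])
    fix h assume "h \<in> M <#> N"
    then obtain a b where ab: "a \<in> M" "b \<in> N" "h = a \<otimes> b" unfolding set_mult_def by blast
    then obtain f where f: "f \<in> F" "b \<otimes> inv f \<in> M" using F(3) assms(5) by blast
    have "a \<otimes> b \<otimes> inv f = a \<otimes> (b \<otimes> inv f)"
      using ab f F(2) subgroup.subset[OF assms(1)] subgroup.subset[OF assms(2)]
      by (intro m_assoc) auto
    then have "h \<otimes> inv f \<in> M" using ab f(2) assms(1) by (simp add: subgroup_def)
    then show "\<exists>f\<in>F. h \<otimes> inv f \<in> M" using f(1) by blast
  qed
  moreover have "M <#> N \<subseteq> carrier G"
    using subgroup.subset[OF assms(1)] subgroup.subset[OF assms(2)] by (rule set_mult_closed)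
  ultimately show ?thesis using finite_index_trans[OF assms(3)] by blast
qed

text \<open>The candidates are directed under products, so their union is a subgroup. It is finitely
  generated, and one candidate contains all its generators.\<close>

lemma largest_normal_finite_index_extension:
  assumes N: "N \<lhd> G"
    and noeth: "\<And>L. subgroup L G \<Longrightarrow> \<exists>S. finite S \<and> S \<subseteq> L \<and> generate G S = L"
  obtains M\<^sub>0 where "M\<^sub>0 \<lhd> G" "N \<subseteq> M\<^sub>0" "finite_index N M\<^sub>0"
    "\<And>M. M \<lhd> G \<Longrightarrow> N \<subseteq> M \<Longrightarrow> finite_index N M \<Longrightarrow> M \<subseteq> M\<^sub>0"
proof -
  define \<M> where "\<M> = {M. M \<lhd> G \<and> N \<subseteq> M \<and> finite_index N M}"
  have sg: "subgroup M G" if "M \<in> \<M>" for M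
    using that by (simp add: \<M>_def normal_imp_subgroup)
  have NM: "N \<in> \<M>"
    using N normal_imp_subgroup[OF N] unfolding \<M>_def
    by (auto intro!: finite_indexI[of "{\<one>}"] simp: subgroup.mem_carrier)
  have dir: "\<exists>P\<in>\<M>. M \<union> M' \<subseteq> P" if M: "M \<in> \<M>" "M' \<in> \<M>" for M M'
  proof
    have "finite_index N (M <#> M')"
      using M sg by (intro finite_index_set_mult) (auto simp: \<M>_def)
    then show "M <#> M' \<in> \<M>" using normal_set_mult[of M M'] M by (auto simp: \<M>_def)
    show "M \<union> M' \<subseteq> M <#> M'" using normal_set_mult[of M M'] M by (auto simp: \<M>_def)
  qed
  have U: "subgroup (\<Union>\<M>) G"
  proof (rule subgroupI)
    show "\<Union>\<M> \<subseteq> carrier G" using sg subgroup.subset by blast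
    show "\<Union>\<M> \<noteq> {}" using NM subgroup.one_closed[OF sg[OF NM]] by blast
    fix a assume "a \<in> \<Union>\<M>"
    then obtain M where M: "M \<in> \<M>" "a \<in> M" by blast
    then show "inv a \<in> \<Union>\<M>" using subgroupE(3)[OF sg] by blast
    fix b assume "b \<in> \<Union>\<M>"
    then obtain M' where M': "M' \<in> \<M>" "b \<in> M'" by blast
    obtain P where P: "P \<in> \<M>" "M \<union> M' \<subseteq> P" using dir M M' by blast
    then have "a \<otimes> b \<in> P" using subgroupE(4)[OF sg[OF P(1)]] M M' by blast
    then show "a \<otimes> b \<in> \<Union>\<M>" using P(1) by blast
  qed
  obtain S where S: "finite S" "S \<subseteq> \<Union>\<M>" "generate G S = \<Union>\<M>" using noeth[OF U] by blast
  from S(1,2) have "\<exists>M\<in>\<M>. S \<subseteq> M"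
  proof (induction rule: finite_induct)
    case (insert x S)
    then obtain M M' where "M \<in> \<M>" "S \<subseteq> M" "M' \<in> \<M>" "x \<in> M'" by blast
    then show ?case using dir[of M M'] by blast
  qed (use NM in blast)
  then obtain M\<^sub>0 where M\<^sub>0: "M\<^sub>0 \<in> \<M>" "S \<subseteq> M\<^sub>0" by blast
  have "\<Union>\<M> \<subseteq> M\<^sub>0" using generate_subgroup_incl[OF M\<^sub>0(2) sg[OF M\<^sub>0(1)]] S(3) by simp
  then show thesis using that[of M\<^sub>0] M\<^sub>0(1) unfolding \<M>_def by blast
qed

text \<open>
  \<open>z\<close> acts on the finite group \<open>M\<close> by conjugation, so some \<open>w = z\<^sup>k\<close> centralises \<open>M\<close>. Then
  \<open>g \<otimes> w \<otimes> inv g = t \<otimes> w\<close> with \<open>t \<in> M\<close> commuting with \<open>w\<close>, and raising to the order of \<open>M\<close> kills \<open>t\<close>.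
\<close>

lemma central_power:
  assumes M: "finite M" "subgroup M G" and z: "z \<in> carrier G"
    and comm: "\<And>g. g \<in> carrier G \<Longrightarrow> commutator z g \<in> M"
  obtains k :: nat where "k > 0" "\<And>g. g \<in> carrier G \<Longrightarrow> z [^] k \<otimes> g = g \<otimes> z [^] k"
proof -
  have MG: "t \<in> carrier G" if "t \<in> M" for t using M(2) that by (rule subgroup.mem_carrier)
  have conj: "z \<otimes> t \<otimes> inv z \<in> M" if "t \<in> M" for t
  proof -
    have "commutator z t \<otimes> t \<in> M" using comm MG that M(2) by (simp add: subgroup_def)
    then show ?thesis using z MG[OF that] by (simp add: m_assoc)
  qed
  have conj_pow: "z [^] j \<otimes> t \<otimes> inv (z [^] j) \<in> M" if t: "t \<in> M" for t and j :: nat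
  proof (induction j)
    case (Suc j)
    have "z [^] Suc j \<otimes> t \<otimes> inv (z [^] Suc j) = z \<otimes> (z [^] j \<otimes> t \<otimes> inv (z [^] j)) \<otimes> inv z"
      unfolding nat_pow_Suc2[OF z] using z MG[OF t] by (simp add: m_assoc inv_mult_group)
    then show ?case using conj[OF Suc] by simp
  qed (use t MG[OF t] in simp)
  \<comment> \<open>\<open>\<phi> j\<close> is conjugation by \<open>z [^] j\<close> on
    \<open>M\<close>. There are only finitely many maps from \<open>M\<close> to \<open>M\<close>,
    so two exponents \<open>a < b\<close> give the same one, and \<open>z [^] (b - a)\<close>
    centralises \<open>M\<close>.\<close>
  define \<phi> where "\<phi> j = (\<lambda>t\<in>M. z [^] (j::nat) \<otimes> t \<otimes> inv (z [^] j))" for j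
  have "range \<phi> \<subseteq> M \<rightarrow>\<^sub>E M" using conj_pow by (auto simp: \<phi>_def)
  then have "finite (range \<phi>)" using M(1) by (meson finite_PiE finite_subset)
  then have "\<not> inj \<phi>" using finite_imageD by blast
  then obtain a b where ab: "a < b" "\<phi> a = \<phi> b"
    unfolding inj_on_def by (metis linorder_neqE_nat)
  define w where "w = z [^] (b - a)"
  have w: "w \<in> carrier G" using z by (simp add: w_def)
  have wt: "w \<otimes> t = t \<otimes> w" if t: "t \<in> M" for t
  proof -
    have "z [^] a \<otimes> t \<otimes> inv (z [^] a) = z [^] b \<otimes> t \<otimes> inv (z [^] b)"
      using fun_cong[OF ab(2), of t] t by (simp add: \<phi>_def)
    also have "z [^] b = z [^] a \<otimes> w" using z ab(1) by (simp add: w_def nat_pow_mult)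
    finally have "z [^] a \<otimes> t \<otimes> inv (z [^] a) = z [^] a \<otimes> (w \<otimes> t \<otimes> inv w) \<otimes> inv (z [^] a)"
      using z w MG[OF t] by (simp add: m_assoc inv_mult_group)
    then have "t = w \<otimes> t \<otimes> inv w"
      using z w MG[OF t] by simp
    then have "t \<otimes> w = w \<otimes> t \<otimes> inv w \<otimes> w" by simp
    then show ?thesis using w MG[OF t] by (simp add: m_assoc)
  qed
  have comm_pow: "g \<otimes> z [^] j \<otimes> inv g \<otimes> inv (z [^] j) \<in> M" if g: "g \<in> carrier G" for g and j :: nat
  proof (induction j)
    case 0
    then show ?case using g subgroup.one_closed[OF M(2)] by simp
  next
    case (Suc j)
    have "commutator g z \<in> M"
      using comm[OF g] M(2) inv_commutator[OF z g] by (metis subgroup_def)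
    then have "(commutator g z) \<otimes> (z \<otimes> (g \<otimes> z [^] j \<otimes> inv g \<otimes> inv (z [^] j)) \<otimes> inv z) \<in> M"
      using conj[OF Suc] M(2) by (simp add: subgroup_def)
    also have "(commutator g z) \<otimes> (z \<otimes> (g \<otimes> z [^] j \<otimes> inv g \<otimes> inv (z [^] j)) \<otimes> inv z)
      = g \<otimes> z [^] Suc j \<otimes> inv g \<otimes> inv (z [^] Suc j)"
      unfolding nat_pow_Suc2[OF z] using z g by (simp add: m_assoc inv_mult_group inv_mult_cancel)
    finally show ?case .
  qed
  interpret MG: group "G\<lparr>carrier := M\<rparr>" using M(2) by (rule subgroup_imp_group)
  \<comment> \<open>The factor \<open>card M\<close> annihilates every \<open>t\<close> in
    \<open>M\<close> at once, so \<open>k\<close> does not depend on \<open>g\<close>.\<close>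
  define k where "k = (b - a) * card M"
  have card: "card M > 0" using M subgroup.one_closed by (auto simp: card_gt_0_iff)
  show thesis
  proof
    show "k > 0" using ab card by (simp add: k_def)
    fix g assume g: "g \<in> carrier G"
    define t where "t = g \<otimes> w \<otimes> inv g \<otimes> inv w"
    have t: "t \<in> M" using comm_pow[OF g] by (simp add: t_def w_def)
    have tw: "g \<otimes> w \<otimes> inv g = t \<otimes> w" using g w by (simp add: t_def m_assoc)
    have "t [^] card M = \<one>"
      using MG.pow_order_eq_1[of t] t by (simp add: order_def flip: nat_pow_consistent)
    have "g \<otimes> w [^] n \<otimes> inv g = (g \<otimes> w \<otimes> inv g) [^] n" for n :: nat
    proof (induction n)
      case (Suc n)
      show ?case unfolding nat_pow_Suc Suc[symmetric]
        using g w by (simp add: m_assoc inv_mult_cancel)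
    qed (use g in simp)
    then have "g \<otimes> w [^] card M \<otimes> inv g = (t \<otimes> w) [^] card M" using tw by simp
    also have "\<dots> = w [^] card M"
      using \<open>t [^] card M = \<one>\<close> wt[OF t] w MG[OF t] by (subst pow_mult_distrib) simp_all
    finally have "g \<otimes> w [^] card M \<otimes> inv g \<otimes> g = w [^] card M \<otimes> g" by simp
    moreover have "z [^] k = w [^] card M" using z by (simp add: k_def w_def nat_pow_pow)
    ultimately show "z [^] k \<otimes> g = g \<otimes> z [^] k" using g w by (simp add: m_assoc)
  qed
qed

text \<open>This is \<open>central_power\<close> in the quotient by \<open>N\<close>, where the
  image of \<open>M\<close> is finite.\<close>

lemma central_power_mod:
  assumes N: "N \<lhd> G" and M: "subgroup M G" "finite_index N M" and z: "z \<in> carrier G"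
    and comm: "\<And>g. g \<in> carrier G \<Longrightarrow> commutator z g \<in> M"
  obtains k :: nat where "k > 0" "\<And>g. g \<in> carrier G \<Longrightarrow> commutator (z [^] k) g \<in> N"
proof -
  interpret N: normal N G by (rule N)
  interpret Q: group "G Mod N" by (rule N.factorgroup_is_group)
  interpret \<pi>: group_hom G "G Mod N" "\<lambda>a. N #> a"
    by unfold_locales (rule N.r_coset_hom_Mod)
  have "\<exists>k>0::nat. \<forall>A\<in>carrier (G Mod N).
    (N #> z) [^]\<^bsub>G Mod N\<^esub> k \<otimes>\<^bsub>G Mod N\<^esub> A = A \<otimes>\<^bsub>G Mod N\<^esub> (N #> z) [^]\<^bsub>G Mod N\<^esub> k"
  proof -
    have fin: "finite ((\<lambda>a. N #> a) ` M)"
      using finite_index_iff_finite_cosets[OF N.subgroup_axioms] M subgroup.subset by blast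
    have sg: "subgroup ((\<lambda>a. N #> a) ` M) (G Mod N)"
      using M(1) by (rule \<pi>.subgroup_img_is_subgroup)
    have zQ: "N #> z \<in> carrier (G Mod N)" using z by simp
    show ?thesis
    proof (rule Q.central_power[OF fin sg zQ])
      fix A assume "A \<in> carrier (G Mod N)"
      then obtain g where g: "g \<in> carrier G" "A = N #> g" by (auto simp: carrier_FactGroup)
      have "(N #> z) \<otimes>\<^bsub>G Mod N\<^esub> A \<otimes>\<^bsub>G Mod N\<^esub> inv\<^bsub>G Mod N\<^esub> (N #> z) \<otimes>\<^bsub>G Mod N\<^esub> inv\<^bsub>G Mod N\<^esub> A
          = N #> commutator z g"
        using z g by (simp only: \<pi>.hom_mult[symmetric] \<pi>.hom_inv[symmetric] m_closed inv_closed)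
      then show "(N #> z) \<otimes>\<^bsub>G Mod N\<^esub> A \<otimes>\<^bsub>G Mod N\<^esub> inv\<^bsub>G Mod N\<^esub> (N #> z) \<otimes>\<^bsub>G Mod N\<^esub> inv\<^bsub>G Mod N\<^esub> A
          \<in> (\<lambda>a. N #> a) ` M"
        using comm[OF g(1)] by blast
    qed blast
  qed
  then obtain k :: nat where k: "k > 0" "\<And>A. A \<in> carrier (G Mod N) \<Longrightarrow>
    (N #> z) [^]\<^bsub>G Mod N\<^esub> k \<otimes>\<^bsub>G Mod N\<^esub> A = A \<otimes>\<^bsub>G Mod N\<^esub> (N #> z) [^]\<^bsub>G Mod N\<^esub> k"
    by blast
  have "commutator (z [^] k) g \<in> N" if g: "g \<in> carrier G" for g
  proof -
    have gQ: "N #> g \<in> carrier (G Mod N)" using g by simp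
    have "N #> (z [^] k \<otimes> g) = N #> (g \<otimes> z [^] k)"
      using k(2)[OF gQ] z g
      by (simp only: N.FactGroup_pow \<pi>.hom_mult[symmetric] nat_pow_closed)
    then have "(z [^] k \<otimes> g) \<otimes> inv (g \<otimes> z [^] k) \<in> N"
      using z g by (subst (asm) r_coset_eq_iff[OF N.subgroup_axioms]) simp_all
    then show ?thesis using z g by (simp add: inv_mult_group m_assoc)
  qed
  then show thesis using that k(1) by blast
qed

text \<open>Let \<open>M\<close> be the largest normal extension of \<open>N\<close> with finite
  index. An element \<open>y\<close> outside \<open>M\<close>, taken from the last term of the lower
  central series not contained in \<open>M\<close>, is central modulo \<open>M\<close> and has
  infinite order modulo \<open>M\<close>. A power of it is central modulo \<open>N\<close>.\<close>

lemma central_infinite_order_mod: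
  assumes nil: "nilpotent G" and N: "N \<lhd> G" "\<not> finite_index N (carrier G)"
    and noeth: "\<And>L. subgroup L G \<Longrightarrow> \<exists>S. finite S \<and> S \<subseteq> L \<and> generate G S = L"
  obtains z where "z \<in> carrier G" "\<And>g. g \<in> carrier G \<Longrightarrow> commutator z g \<in> N"
    "\<And>m::nat. m > 0 \<Longrightarrow> z [^] m \<notin> N"
proof -
  obtain M where M: "M \<lhd> G" "N \<subseteq> M" "finite_index N M"
    and max: "\<And>M'. M' \<lhd> G \<Longrightarrow> N \<subseteq> M' \<Longrightarrow> finite_index N M' \<Longrightarrow> M' \<subseteq> M"
    using largest_normal_finite_index_extension[OF N(1) noeth] by blast
  note Msg = normal_imp_subgroup[OF M(1)]
  obtain c where "\<gamma> c = {\<one>}" using nil unfolding nilpotent_def by blast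
  then have c: "\<gamma> c \<subseteq> M" using subgroup.one_closed[OF Msg] by simp
  define n where "n = (LEAST n. \<gamma> n \<subseteq> M)"
  have n: "\<gamma> n \<subseteq> M" unfolding n_def using c by (rule LeastI)
  have "n \<noteq> 0"
  proof
    assume "n = 0"
    then have "carrier G \<subseteq> M" using n by simp
    then show False using M(3) N(2) finite_index_mono by blast
  qed
  then obtain n' where n': "n = Suc n'" by (cases n) auto
  then have "\<not> \<gamma> n' \<subseteq> M" using not_less_Least[of n' "\<lambda>n. \<gamma> n \<subseteq> M"] by (simp add: n_def)
  then obtain y where y: "y \<in> \<gamma> n'" "y \<notin> M" by blast
  then have yG: "y \<in> carrier G" using lower_central_series_carrier by blast
  have yc: "commutator y g \<in> M" if "g \<in> carrier G" for g
    using lower_central_series_commutator[OF y(1) that] n n' by blast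
  have ym: "y [^] m \<notin> M" if m: "m > 0" for m :: nat
  proof
    assume my: "y [^] m \<in> M"
    note A = adjoin[OF M(1) yG]
    \<comment> \<open>If \<open>y [^] m\<close> lies in \<open>M\<close>, the powers of
      \<open>y\<close> below \<open>m\<close> represent all cosets of \<open>M\<close> in
      \<open>adjoin M y\<close>. Then \<open>adjoin M y\<close> is normal of finite index over
      \<open>N\<close>, against the maximality of \<open>M\<close>.\<close>
    have "finite_index M (adjoin M y)"
    proof (rule finite_indexI)
      show "finite ((\<lambda>r::nat. y [^] r) ` {..<m})" by simp
      show "(\<lambda>r::nat. y [^] r) ` {..<m} \<subseteq> carrier G" using yG by auto
      fix k assume "k \<in> adjoin M y"
      then obtain i where k: "k \<in> carrier G" "k \<otimes> inv (y [^] (i::int)) \<in> M"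
        by (auto simp: adjoin_def)
      define q r where "q = i div int m" and "r = nat (i mod int m)"
      have r: "r < m" "int r = i mod int m" using m by (simp_all add: r_def nat_less_iff)
      have "y [^] i = (y [^] int m) [^] q \<otimes> y [^] r"
        using yG r(2) by (simp add: int_pow_pow q_def flip: int_pow_int int_pow_mult)
      moreover have "(y [^] int m) [^] q \<in> M"
        using my subgroup_int_pow_closed[OF Msg] by (simp add: int_pow_int)
      ultimately have yM: "y [^] i \<otimes> inv (y [^] r) \<in> M"
        using yG by (simp add: m_assoc)
      have "(k \<otimes> inv (y [^] i)) \<otimes> (y [^] i \<otimes> inv (y [^] r)) \<in> M"
        using k(2) yM Msg by (simp add: subgroup_def)
      then have "k \<otimes> inv (y [^] r) \<in> M"
        using k(1) yG by (simp add: m_assoc inv_mult_cancel)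
      then show "\<exists>f\<in>(\<lambda>r::nat. y [^] r) ` {..<m}. k \<otimes> inv f \<in> M" using r(1) by blast
    qed
    then have "finite_index N (adjoin M y)"
      using finite_index_trans[OF M(3)] subgroup.subset[OF A(1)] by blast
    then have "adjoin M y \<subseteq> M"
      using max[OF adjoin_normal[OF M(1) yG yc]] A(2) M(2) by blast
    then show False using A(3) y(2) by blast
  qed
  obtain k :: nat where k: "k > 0" "\<And>g. g \<in> carrier G \<Longrightarrow> commutator (y [^] k) g \<in> N"
    using central_power_mod[OF N(1) Msg M(3) yG yc] by blast
  show thesis
  proof
    show "y [^] k \<in> carrier G" using yG by simp
    show "commutator (y [^] k) g \<in> N" if "g \<in> carrier G" for g using k(2) that .
    show "(y [^] k) [^] m \<notin> N" if "m > 0" for m :: nat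
      using ym[of "k * m"] that k(1) M(2) yG by (auto simp: nat_pow_pow)
  qed
qed

text \<open>As \<open>z\<close> has infinite order modulo \<open>N\<close>, each \<open>g\<close> in
  \<open>E\<close> agrees modulo \<open>N\<close> with at most one power of \<open>z\<close>. A
  power \<open>y\<close> of \<open>z\<close> beyond all these exponents has no nontrivial power
  agreeing with any \<open>g\<close> in \<open>E\<close>.\<close>

lemma adjoin_avoiding:
  assumes N: "N \<lhd> G" and z: "z \<in> carrier G" "\<And>g. g \<in> carrier G \<Longrightarrow> commutator z g \<in> N"
    and inf: "\<And>m::nat. m > 0 \<Longrightarrow> z [^] m \<notin> N" and E: "finite E" "E \<subseteq> carrier G"
  obtains y where "y \<in> carrier G" "y \<notin> N" "\<And>g. g \<in> carrier G \<Longrightarrow> commutator y g \<in> N"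
    "\<And>g. g \<in> E \<Longrightarrow> g \<in> adjoin N y \<Longrightarrow> g \<in> N"
proof -
  note Nsg = normal_imp_subgroup[OF N]
  define T where "T g = {e::int. g \<otimes> inv (z [^] e) \<in> N}" for g
  have inf': "e = 0" if "z [^] (e::int) \<in> N" for e
  proof (rule ccontr)
    assume "e \<noteq> 0"
    have "z [^] \<bar>e\<bar> \<in> N"
      using that z(1) subgroupE(3)[OF Nsg] by (auto simp: abs_if int_pow_neg)
    then have "z [^] nat \<bar>e\<bar> \<in> N" by (simp flip: int_pow_int)
    then show False using inf[of "nat \<bar>e\<bar>"] \<open>e \<noteq> 0\<close> by simp
  qed
  have single: "e = e'" if "g \<in> E" "e \<in> T g" "e' \<in> T g" for g e e'
  proof -
    have g: "g \<in> carrier G" using that E(2) by blast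
    have "inv (g \<otimes> inv (z [^] e)) \<otimes> (g \<otimes> inv (z [^] e')) \<in> N"
      using that Nsg by (simp add: T_def subgroup_def)
    also have "inv (g \<otimes> inv (z [^] e)) \<otimes> (g \<otimes> inv (z [^] e')) = z [^] (e - e')"
      using g z(1) by (simp add: inv_mult_group m_assoc inv_mult_cancel int_pow_diff)
    finally show ?thesis using inf' by fastforce
  qed
  have "finite (T g)" if "g \<in> E" for g
  proof (cases "T g = {}")
    case False
    then obtain e where "e \<in> T g" by blast
    then have "T g \<subseteq> {e}" using single[OF that] by blast
    then show ?thesis using finite_subset by blast
  qed simp
  then have "finite (nat ` abs ` (\<Union>g\<in>E. T g))" using E(1) by blast
  then obtain j where j: "nat ` abs ` (\<Union>g\<in>E. T g) \<subseteq> {..<j}"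
    unfolding finite_nat_iff_bounded by (rule exE)
  \<comment> \<open>All relevant exponents are below \<open>j\<close> in absolute value. Taking
    \<open>Suc j\<close> keeps the exponent positive even for \<open>j = 0\<close>, so that
    \<open>y \<notin> N\<close>.\<close>
  define y where "y = z [^] Suc j"
  have y: "y = z [^] int (Suc j)" unfolding y_def by (simp only: int_pow_int)
  show thesis
  proof
    show "y \<in> carrier G" unfolding y_def using z(1) by (rule nat_pow_closed)
    show "y \<notin> N" unfolding y_def using inf by blast
    fix g assume g: "g \<in> carrier G"
    have "z [^] int (Suc j) \<in> {a \<in> carrier G. commutator a g \<in> N}"
      by (rule subgroup_int_pow_closed[OF subgroup_centralizer_mod'[OF N g]]) (use z g in simp)
    then show "commutator y g \<in> N" unfolding y by simp
  next
    fix g assume g: "g \<in> E" "g \<in> adjoin N y"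
    then obtain m where m: "g \<otimes> inv (y [^] (m::int)) \<in> N" by (auto simp: adjoin_def)
    then have mT: "int (Suc j) * m \<in> T g"
      unfolding T_def y using z(1) by (simp only: int_pow_pow mem_Collect_eq)
    then have "nat \<bar>int (Suc j) * m\<bar> < j" using j g(1) by fast
    then have less: "int (Suc j) * \<bar>m\<bar> < int j" by (simp add: abs_mult nat_less_iff)
    have "m = 0"
    proof (rule ccontr)
      assume "m \<noteq> 0"
      then have "int (Suc j) * 1 \<le> int (Suc j) * \<bar>m\<bar>" by (intro mult_left_mono) auto
      then have "int (Suc j) * 1 < int j" using less by (rule le_less_trans)
      then show False by simp
    qed
    then show "g \<in> N" using m g(1) E(2) by auto
  qed
qed

end

section \<open>Derivatives of the space of normal subgroups\<close>

text \<open>Without a largest element the \<open>LEAST\<close> in the \<open>Suc\<close> clause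
  ranges over a nonempty set, so it is a true successor.\<close>

lemma finite_ordinal_is_pred:
  assumes "\<And>\<alpha> :: 'o::wellorder. \<exists>\<beta>. \<alpha> < \<beta>"
  shows "is_pred (finite_ordinal n :: 'o) (finite_ordinal (Suc n))"
proof -
  have "(finite_ordinal n :: 'o) < finite_ordinal (Suc n)"
    using assms[of "finite_ordinal n"] by (auto intro: LeastI)
  moreover have "\<gamma> \<le> finite_ordinal n" if "\<gamma> < finite_ordinal (Suc n)" for \<gamma> :: 'o
    using not_less_Least[of \<gamma> "\<lambda>\<alpha>. finite_ordinal n < \<alpha>"] that by (simp add: not_less)
  ultimately show ?thesis unfolding is_pred_def by blast
qed

lemma cb_derivative_antimono:
  assumes "\<alpha> \<le> \<beta>"
  shows "cb_derivative X \<beta> \<subseteq> cb_derivative X (\<alpha> :: 'o::wellorder)"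
  using assms
proof (induction \<beta> rule: less_induct)
  case (less \<beta>)
  show ?case
  proof (cases "\<alpha> = \<beta>")
    case False
    then have lt: "\<alpha> < \<beta>" using less.prems by simp
    show ?thesis
    proof (cases "\<exists>\<gamma>. is_pred \<gamma> \<beta>")
      case True
      then obtain \<gamma> where \<gamma>: "is_pred \<gamma> \<beta>" ..
      then have "\<gamma> < \<beta>" "\<alpha> \<le> \<gamma>" using lt by (auto simp: is_pred_def)
      then have "cb_derivative X \<gamma> \<subseteq> cb_derivative X \<alpha>" by (rule less.IH)
      then show ?thesis
        using cb_derivative_succ[OF \<gamma>] derived_set_of_subset_subtopology by fastforce
    next
      case False
      then have "cb_derivative X \<beta> = (\<Inter>\<gamma>\<in>{..<\<beta>}. cb_derivative X \<gamma>)"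
        by (intro cb_derivative_limit[OF lt]) blast
      then show ?thesis using lt by blast
    qed
  qed simp
qed

lemma sum_nat_ordinal_no_top: "\<exists>\<beta>. (\<alpha> :: ('x + nat) ordinal) < \<beta>"
  by (rule ordinal_no_top) (simp add: UNIV_sum finite_image_iff)

text \<open>Finite stages decide the rank: an ordinal not below \<open>finite_ordinal n\<close> is
  at least its successor, and the derivatives decrease.\<close>

lemma cb_rank_at_eq_finite_ordinal:
  fixes X :: "'x topology"
  assumes "\<And>m. x \<in> cb_derivative X (finite_ordinal m :: ('x + nat) ordinal) \<longleftrightarrow> m \<le> n"
  shows "cb_rank_at X x = Some (finite_ordinal n)"
proof -
  let ?S = "{\<alpha> :: ('x + nat) ordinal. x \<in> cb_derivative X \<alpha>}"
  let ?f = "finite_ordinal :: nat \<Rightarrow> ('x + nat) ordinal"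
  have pred: "is_pred (?f n) (?f (Suc n))"
    using sum_nat_ordinal_no_top by (rule finite_ordinal_is_pred)
  have mem: "?f n \<in> ?S" using assms by simp
  have upper: "\<alpha> \<le> ?f n" if "\<alpha> \<in> ?S" for \<alpha>
  proof (rule ccontr)
    assume "\<not> \<alpha> \<le> ?f n"
    then have le: "?f (Suc n) \<le> \<alpha>" using pred unfolding is_pred_def by (meson not_le)
    have "x \<in> cb_derivative X (?f (Suc n))"
      using subsetD[OF cb_derivative_antimono[OF le]] that by simp
    then show False using assms[of "Suc n"] by (simp del: finite_ordinal.simps)
  qed
  have "(LEAST \<beta>. \<forall>\<alpha>\<in>?S. \<alpha> \<le> \<beta>) = ?f n"
    by (rule Least_equality) (use upper mem in blast)+
  moreover have "\<exists>\<beta>. \<forall>\<alpha>\<in>?S. \<alpha> \<le> \<beta>" using upper by blast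
  ultimately show ?thesis unfolding cb_rank_at_def Let_def by simp
qed

section \<open>Neighbourhoods in the space of normal subgroups\<close>

lemma topspace_normal_subgroup_space: "topspace (normal_subgroup_space G) = {N. N \<lhd> G}"
  by (auto simp: normal_subgroup_space_def topspace_pullback_topology)

text \<open>For normal \<open>N\<close> these cylinder sets form a neighbourhood base at
  \<open>N\<close>; \<open>openin_normal_subgroup_space_nhd\<close> supplies the other half.\<close>

lemma openin_normal_subgroup_space_basic:
  assumes "finite E" "E \<subseteq> carrier G"
  shows "openin (normal_subgroup_space G) {M. M \<lhd> G \<and> (\<forall>g\<in>E. g \<in> M \<longleftrightarrow> g \<in> N)}"
proof -
  define U where "U = (\<Pi>\<^sub>E g\<in>carrier G. if g \<in> E then {g \<in> N} else UNIV)"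
  have "finite {g. (if g \<in> E then {g \<in> N} else UNIV) \<noteq> (UNIV :: bool set)}"
    by (rule finite_subset[OF _ assms(1)]) auto
  then have "openin (product_topology (\<lambda>_. discrete_topology (UNIV :: bool set)) (carrier G)) U"
    unfolding U_def by (intro product_topology_basis) simp_all
  moreover have "(\<lambda>g\<in>carrier G. g \<in> M) \<in> U \<longleftrightarrow> (\<forall>g\<in>E. g \<in> M \<longleftrightarrow> g \<in> N)" for M
  proof -
    have "(g \<in> M) \<in> (if g \<in> E then {g \<in> N} else UNIV) \<longleftrightarrow> (g \<in> E \<longrightarrow> (g \<in> M \<longleftrightarrow> g \<in> N))" for g
      by simp
    then show ?thesis using assms(2) unfolding U_def restrict_PiE_iff by blast
  qed
  then have "{M. M \<lhd> G \<and> (\<forall>g\<in>E. g \<in> M \<longleftrightarrow> g \<in> N)} =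
      (\<lambda>M. \<lambda>g\<in>carrier G. g \<in> M) -` U \<inter> {M. M \<lhd> G}"
    by auto
  ultimately show ?thesis
    unfolding normal_subgroup_space_def openin_pullback_topology by blast
qed

lemma openin_normal_subgroup_space_nhd:
  assumes "openin (normal_subgroup_space G) T" "N \<in> T"
  obtains E where "finite E" "E \<subseteq> carrier G"
    "\<And>M. M \<lhd> G \<Longrightarrow> (\<And>g. g \<in> E \<Longrightarrow> g \<in> M \<longleftrightarrow> g \<in> N) \<Longrightarrow> M \<in> T"
proof -
  obtain U where U: "openin (product_topology (\<lambda>_. discrete_topology (UNIV :: bool set)) (carrier G)) U"
    and T: "T = (\<lambda>M. \<lambda>g\<in>carrier G. g \<in> M) -` U \<inter> {M. M \<lhd> G}"
    using assms(1) unfolding normal_subgroup_space_def openin_pullback_topology by blast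
  have "(\<lambda>g\<in>carrier G. g \<in> N) \<in> U" using assms(2) T by blast
  \<comment> \<open>The set \<open>E\<close> will consist of the finitely many coordinates on which
    the basic open set \<open>V\<close> imposes a restriction.\<close>
  then obtain V where V: "finite {g \<in> carrier G. V g \<noteq> (UNIV :: bool set)}"
      "(\<lambda>g\<in>carrier G. g \<in> N) \<in> Pi\<^sub>E (carrier G) V" "Pi\<^sub>E (carrier G) V \<subseteq> U"
    using U unfolding openin_product_topology_alt topspace_discrete_topology by blast
  show thesis
  proof
    show "finite {g \<in> carrier G. V g \<noteq> UNIV}" by (rule V(1))
    fix M assume M: "M \<lhd> G" "\<And>g. g \<in> {g \<in> carrier G. V g \<noteq> UNIV} \<Longrightarrow> g \<in> M \<longleftrightarrow> g \<in> N"
    have "(\<lambda>g\<in>carrier G. g \<in> M) \<in> Pi\<^sub>E (carrier G) V"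
    proof (rule restrict_PiE_iff[THEN iffD2], rule ballI)
      fix g assume g: "g \<in> carrier G"
      have "(g \<in> N) \<in> V g" using V(2) g unfolding restrict_PiE_iff by blast
      then show "(g \<in> M) \<in> V g" using M(2)[of g] g by (cases "V g = UNIV") auto
    qed
    then show "M \<in> T" using V(3) T M(1) by blast
  qed blast
qed

context group
begin

text \<open>Let \<open>E\<close> consist of generators of \<open>N\<close> and representatives of
  the largest finite-index normal extension modulo \<open>N\<close>. Agreement on the generators
  gives \<open>N \<subseteq> M\<close>. If the index were finite, an element of \<open>M\<close>
  outside \<open>N\<close> would have its representative in \<open>M\<close>, hence in
  \<open>N\<close>, a contradiction.\<close>

lemma normal_extension_infinite_index_nhd:
  assumes N: "N \<lhd> G"
    and noeth: "\<And>L. subgroup L G \<Longrightarrow> \<exists>S. finite S \<and> S \<subseteq> L \<and> generate G S = L"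
  obtains E where "finite E" "E \<subseteq> carrier G"
    "\<And>M. M \<lhd> G \<Longrightarrow> (\<And>g. g \<in> E \<Longrightarrow> g \<in> M \<longleftrightarrow> g \<in> N) \<Longrightarrow> N \<subseteq> M"
    "\<And>M. M \<lhd> G \<Longrightarrow> (\<And>g. g \<in> E \<Longrightarrow> g \<in> M \<longleftrightarrow> g \<in> N) \<Longrightarrow> M \<noteq> N \<Longrightarrow> \<not> finite_index N M"
proof -
  note Nsg = normal_imp_subgroup[OF N]
  obtain S where S: "finite S" "S \<subseteq> N" "generate G S = N" using noeth[OF Nsg] by blast
  obtain M\<^sub>0 where M\<^sub>0: "M\<^sub>0 \<lhd> G" "N \<subseteq> M\<^sub>0" "finite_index N M\<^sub>0"
    and max: "\<And>M. M \<lhd> G \<Longrightarrow> N \<subseteq> M \<Longrightarrow> finite_index N M \<Longrightarrow> M \<subseteq> M\<^sub>0"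
    using largest_normal_finite_index_extension[OF N noeth] by blast
  obtain F where F: "finite F" "F \<subseteq> carrier G" "\<forall>k\<in>M\<^sub>0. \<exists>f\<in>F. k \<otimes> inv f \<in> N"
    using M\<^sub>0(3) unfolding finite_index_def by blast
  have sub: "N \<subseteq> M" if "M \<lhd> G" "\<And>g. g \<in> S \<union> F \<Longrightarrow> g \<in> M \<longleftrightarrow> g \<in> N" for M
    using generate_subgroup_incl[of S M] normal_imp_subgroup[OF that(1)] that(2) S(2,3) by blast
  have "\<not> finite_index N M"
    if M: "M \<lhd> G" "\<And>g. g \<in> S \<union> F \<Longrightarrow> g \<in> M \<longleftrightarrow> g \<in> N" "M \<noteq> N" for M
  proof
    assume fin: "finite_index N M"
    note Msg = normal_imp_subgroup[OF M(1)]
    have NM: "N \<subseteq> M" using sub M(1,2) by blast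
    then obtain k where k: "k \<in> M" "k \<notin> N" using M(3) by blast
    then have "k \<in> M\<^sub>0" using max[OF M(1) NM fin] by blast
    then obtain f where f: "f \<in> F" "k \<otimes> inv f \<in> N" using F(3) by blast
    have c: "k \<in> carrier G" "f \<in> carrier G" using k(1) f(1) F(2) subgroup.subset[OF Msg] by auto
    have "inv (k \<otimes> inv f) \<otimes> k \<in> M"
      using f(2) NM k(1) Msg by (simp add: subgroup_def subset_iff)
    then have "f \<in> M" using c by (simp add: inv_mult_group m_assoc)
    then have "f \<in> N" using M(2) f(1) by blast
    then have "k \<otimes> inv f \<otimes> f \<in> N" using f(2) subgroupE(4)[OF Nsg] by blast
    then show False using c k(2) by (simp add: m_assoc)
  qed
  moreover have "S \<union> F \<subseteq> carrier G" using S(2) F(2) subgroup.subset[OF Nsg] by blast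
  ultimately show thesis using that[of "S \<union> F"] S(1) F(1) sub by blast
qed

section \<open>Hirsch length as maximal chain length\<close>

definition hirsch_dim :: "'a set \<Rightarrow> nat" where
  "hirsch_dim K = (GREATEST n. infinite_index_chain n K)"

text \<open>Chains in \<open>K\<close> are chains in \<open>G\<close> and so have bounded length;
  thus the \<open>GREATEST\<close> is attained, and shorter lengths follow.\<close>

lemma infinite_index_chain_iff_hirsch_dim:
  assumes "polycyclic (carrier G)" "subgroup K G"
  shows "infinite_index_chain n K \<longleftrightarrow> n \<le> hirsch_dim K"
proof -
  obtain d where d: "\<And>n. infinite_index_chain n (carrier G) \<longleftrightarrow> n \<le> d"
    using polycyclic_infinite_index_chain[OF assms(1)] by blast
  have bound: "n \<le> d" if "infinite_index_chain n K" for n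
    using infinite_index_chain_mono[OF that subgroup.subset[OF assms(2)]] d by blast
  have "infinite_index_chain (hirsch_dim K) K"
    unfolding hirsch_dim_def by (rule GreatestI_nat[of _ 0 d]) (use bound in auto)
  moreover have "n \<le> hirsch_dim K" if "infinite_index_chain n K"
    unfolding hirsch_dim_def by (rule Greatest_le_nat[of _ _ d]) (use bound that in auto)
  ultimately show ?thesis using infinite_index_chain_antimono by blast
qed

lemma hirsch_dim_eqI:
  assumes "\<And>n. infinite_index_chain n K \<longleftrightarrow> n \<le> d"
  shows "hirsch_dim K = d"
  unfolding hirsch_dim_def by (rule Greatest_equality) (simp_all add: assms)

text \<open>This connects the elementwise notion with the factor groups in
  \<open>cyclic_subnormal_series\<close>.\<close>

lemma cyclic_extension_iff:
  assumes "subgroup H G" "subgroup K G"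
  shows "(\<exists>x. cyclic_extension H K x) \<longleftrightarrow>
    H \<lhd> G\<lparr>carrier := K\<rparr> \<and> cyclic_group (G\<lparr>carrier := K\<rparr> Mod H)" (is "?lhs \<longleftrightarrow> ?rhs")
proof -
  interpret K: group "G\<lparr>carrier := K\<rparr>" using assms(2) by (rule subgroup_imp_group)
  have KG: "k \<in> carrier G" if "k \<in> K" for k using assms(2) that by (rule subgroup.mem_carrier)
  have inv: "inv\<^bsub>G\<lparr>carrier := K\<rparr>\<^esub> k = inv k" if "k \<in> K" for k
    using assms(2) that by simp
  have coset: "H #>\<^bsub>G\<lparr>carrier := K\<rparr>\<^esub> k = H #> k" for k
    by (simp add: r_coset_def)
  have normal_iff: "H \<lhd> G\<lparr>carrier := K\<rparr> \<longleftrightarrow> H \<subseteq> K \<and> (\<forall>k\<in>K. \<forall>h\<in>H. k \<otimes> h \<otimes> inv k \<in> H)"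
  proof -
    have "subgroup H (G\<lparr>carrier := K\<rparr>) \<longleftrightarrow> H \<subseteq> K"
      using subgroup_incl[OF assms] subgroup.subset[of H "G\<lparr>carrier := K\<rparr>"] by auto
    then show ?thesis using inv by (simp add: K.normal_inv_iff)
  qed
  have cyclic_iff: "cyclic_group (G\<lparr>carrier := K\<rparr> Mod H) \<longleftrightarrow>
      (\<exists>x\<in>K. \<forall>k\<in>K. \<exists>m::int. k \<otimes> inv (x [^] m) \<in> H)" if N: "H \<lhd> G\<lparr>carrier := K\<rparr>"
  proof -
    interpret N: normal H "G\<lparr>carrier := K\<rparr>" by (rule N)
    interpret Q: group "G\<lparr>carrier := K\<rparr> Mod H" by (rule N.factorgroup_is_group)
    have carrier: "carrier (G\<lparr>carrier := K\<rparr> Mod H) = (\<lambda>k. H #> k) ` K"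
      by (simp add: carrier_FactGroup coset)
    have pow: "(H #> x) [^]\<^bsub>G\<lparr>carrier := K\<rparr> Mod H\<^esub> m = H #> (x [^] m)"
      if "x \<in> K" for x and m :: int
      using N.FactGroup_int_pow[of x m] that int_pow_consistent[OF assms(2) that] by (simp add: coset)
    have pK: "x [^] m \<in> K" if "x \<in> K" for x and m :: int
      using assms(2) that by (rule subgroup_int_pow_closed)
    have eq: "H #> k = H #> (x [^] m) \<longleftrightarrow> k \<otimes> inv (x [^] m) \<in> H"
      if "x \<in> K" "k \<in> K" for x k and m :: int
      using that KG by (intro r_coset_eq_iff[OF assms(1)]) simp_all
    have "(\<lambda>k. H #> k) ` K = range (\<lambda>m::int. (H #> x) [^]\<^bsub>G\<lparr>carrier := K\<rparr> Mod H\<^esub> m) \<longleftrightarrow>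
        (\<forall>k\<in>K. \<exists>m::int. k \<otimes> inv (x [^] m) \<in> H)" (is "?A = ?B \<longleftrightarrow> ?C") if x: "x \<in> K" for x
    proof -
      have "?B \<subseteq> ?A" using x pK pow by auto
      moreover have "?A \<subseteq> ?B \<longleftrightarrow> ?C"
        using x eq pow by (auto simp: image_subset_iff image_iff)
      ultimately show ?thesis by blast
    qed
    then show ?thesis unfolding Q.cyclic_group carrier by auto
  qed
  show ?thesis
    using assms normal_iff cyclic_iff unfolding cyclic_extension_def by blast
qed

lemma finite_series_factor_iff:
  assumes "subgroup H G" "subgroup K G"
  shows "finite (carrier (G\<lparr>carrier := K\<rparr> Mod H)) \<longleftrightarrow> finite_index H K"
proof -
  have "carrier (G\<lparr>carrier := K\<rparr> Mod H) = (\<lambda>k. H #> k) ` K"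
    by (simp add: carrier_FactGroup r_coset_def)
  then show ?thesis
    using finite_index_iff_finite_cosets[OF assms(1)] subgroup.subset[OF assms(2)] by simp
qed

text \<open>The left side does not mention the series, so the count is the same for every series.
  This is the uniqueness behind the \<open>THE\<close> in \<open>hirsch_length\<close>.\<close>

lemma cyclic_subnormal_series_infinite_factors:
  assumes "cyclic_subnormal_series G k H"
  shows "hirsch_dim (carrier G) = card {i. i < k \<and> infinite (carrier (series_factor G H i))}"
proof -
  have H: "H 0 = {\<one>}" "H k = carrier G" "\<And>i. i \<le> k \<Longrightarrow> subgroup (H i) G"
    and step: "\<And>i. i < k \<Longrightarrow> H i \<lhd> G\<lparr>carrier := H (Suc i)\<rparr> \<and> cyclic_group (series_factor G H i)"
    using assms unfolding cyclic_subnormal_series_def by blast+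
  define c where "c j = card {i. i < j \<and> infinite (carrier (series_factor G H i))}" for j
  have "infinite_index_chain n (H j) \<longleftrightarrow> n \<le> c j" if "j \<le> k" for j n
    using that
  proof (induction j arbitrary: n)
    case 0
    then show ?case using infinite_index_chain_trivial by (simp add: H(1) c_def)
  next
    case (Suc j)
    have sg: "subgroup (H j) G" "subgroup (H (Suc j)) G" using H(3) Suc.prems by simp_all
    obtain x where "cyclic_extension (H j) (H (Suc j)) x"
      using cyclic_extension_iff[OF sg] step[of j] Suc.prems by auto
    then have "infinite_index_chain n (H (Suc j)) \<longleftrightarrow>
        n \<le> (if finite_index (H j) (H (Suc j)) then c j else Suc (c j))"
      using infinite_index_chain_cyclic_extension_iff Suc by simp
    moreover have "{i. i < Suc j \<and> infinite (carrier (series_factor G H i))} =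
        {i. i < j \<and> infinite (carrier (series_factor G H i))} \<union>
        (if finite_index (H j) (H (Suc j)) then {} else {j})"
      using finite_series_factor_iff[OF sg] by (auto simp: less_Suc_eq)
    then have "c (Suc j) = (if finite_index (H j) (H (Suc j)) then c j else Suc (c j))"
      by (simp add: c_def)
    ultimately show ?case by simp
  qed
  then have "infinite_index_chain n (carrier G) \<longleftrightarrow> n \<le> c k" for n
    using H(2) by (metis order_refl)
  then show ?thesis unfolding c_def by (rule hirsch_dim_eqI)
qed

lemma polycyclic_cyclic_subnormal_series:
  assumes "polycyclic K"
  shows "\<exists>k H. H 0 = {\<one>} \<and> H k = K \<and> (\<forall>i\<le>k. subgroup (H i) G) \<and>
    (\<forall>i<k. H i \<lhd> G\<lparr>carrier := H (Suc i)\<rparr> \<and> cyclic_group (series_factor G H i))"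
  using assms
proof (induction rule: polycyclic.induct)
  case trivial
  show ?case using triv_subgroup by (intro exI[of _ 0] exI[of _ "\<lambda>_. {\<one>}"]) simp
next
  case (extension L K x)
  then obtain k H where H: "H 0 = {\<one>}" "H k = L" "\<And>i. i \<le> k \<Longrightarrow> subgroup (H i) G"
    "\<And>i. i < k \<Longrightarrow> H i \<lhd> G\<lparr>carrier := H (Suc i)\<rparr> \<and> cyclic_group (series_factor G H i)"
    by blast
  have K: "subgroup K G" "subgroup L G" using cyclic_extensionD(1,2)[OF extension(2)] by blast+
  then have top: "L \<lhd> G\<lparr>carrier := K\<rparr> \<and> cyclic_group (G\<lparr>carrier := K\<rparr> Mod L)"
    using cyclic_extension_iff extension(2) by blast
  define H' where "H' = H(Suc k := K)"
  have "H' 0 = {\<one>}" "H' (Suc k) = K" by (simp_all add: H'_def H)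
  moreover have "subgroup (H' i) G" if "i \<le> Suc k" for i
    using that H(3) K(1) by (auto simp: H'_def le_Suc_eq)
  moreover have "H' i \<lhd> G\<lparr>carrier := H' (Suc i)\<rparr> \<and> cyclic_group (series_factor G H' i)"
    if "i < Suc k" for i
    using that H(2,4) top by (cases "i = k") (auto simp: H'_def)
  ultimately show ?case by blast
qed

lemma hirsch_length_eq_hirsch_dim:
  assumes "polycyclic (carrier G)"
  shows "hirsch_length G = hirsch_dim (carrier G)"
proof -
  obtain k H where H: "cyclic_subnormal_series G k H"
    using polycyclic_cyclic_subnormal_series[OF assms] unfolding cyclic_subnormal_series_def by blast
  show ?thesis
    unfolding hirsch_length_def
  proof (rule the_equality)
    show "\<exists>k H. cyclic_subnormal_series G k H \<and>
        hirsch_dim (carrier G) = card {i. i < k \<and> infinite (carrier (series_factor G H i))}"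
      using H cyclic_subnormal_series_infinite_factors[OF H] by blast
  next
    fix n
    assume "\<exists>k H. cyclic_subnormal_series G k H \<and>
        n = card {i. i < k \<and> infinite (carrier (series_factor G H i))}"
    then obtain k H where "cyclic_subnormal_series G k H"
      "n = card {i. i < k \<and> infinite (carrier (series_factor G H i))}" by blast
    then show "n = hirsch_dim (carrier G)"
      using cyclic_subnormal_series_infinite_factors by simp
  qed
qed

section \<open>The finite derivatives\<close>

text \<open>Each derivative lowers the bound on \<open>hirsch_dim\<close> by exactly one: normal
  subgroups near \<open>N\<close> and distinct from it have dimension at least one higher, and
  adjoining one suitable element raises it by at most one.\<close>

lemma cb_derivative_normal_subgroup_space:
  assumes fg: "finitely_generated G" and nil: "nilpotent G"
    and no_top: "\<And>\<alpha> :: 'o::wellorder. \<exists>\<beta>. \<alpha> < \<beta>"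
  shows "cb_derivative (normal_subgroup_space G) (finite_ordinal n :: 'o) =
    {N. N \<lhd> G \<and> hirsch_dim N + n \<le> hirsch_dim (carrier G)}"
proof (induction n)
  have poly: "polycyclic (carrier G)" using fg nil by (rule nilpotent_polycyclic)
  note chain_iff = infinite_index_chain_iff_hirsch_dim[OF poly]
  case 0
  have "hirsch_dim N \<le> hirsch_dim (carrier G)" if "N \<lhd> G" for N
    using chain_iff[OF normal_imp_subgroup[OF that]] chain_iff[OF subgroup_self]
      infinite_index_chain_mono[of _ N "carrier G"] subgroup.subset[OF normal_imp_subgroup[OF that]]
    by blast
  then show ?case
    by (auto simp: cb_derivative_zero topspace_normal_subgroup_space)
next
  have poly: "polycyclic (carrier G)" using fg nil by (rule nilpotent_polycyclic)
  note chain_iff = infinite_index_chain_iff_hirsch_dim[OF poly]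
  have noeth: "\<exists>S. finite S \<and> S \<subseteq> L \<and> generate G S = L" if "subgroup L G" for L
    using polycyclic_noetherian[OF poly that subgroup.subset[OF that]] .
  case (Suc n)
  let ?X = "normal_subgroup_space G"
  let ?D = "\<lambda>n. {N. N \<lhd> G \<and> hirsch_dim N + n \<le> hirsch_dim (carrier G)}"
  \<comment> \<open>The derived set within a subspace is the derived set in the whole space, cut
    down to the subspace.\<close>
  have eq: "cb_derivative ?X (finite_ordinal (Suc n) :: 'o) = ?D n \<inter> ?X derived_set_of ?D n"
    unfolding cb_derivative_succ[OF finite_ordinal_is_pred[OF no_top]] Suc
    by (simp only: derived_set_of_subtopology Int_absorb)
  have upper: "N \<in> ?D (Suc n)" if "N \<in> ?D n \<inter> ?X derived_set_of ?D n" for N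
  proof -
    have N: "N \<in> ?D n" "N \<in> ?X derived_set_of ?D n" using that by (rule IntD1, rule IntD2)
    then have NG: "N \<lhd> G" by simp
    obtain E where E: "finite E" "E \<subseteq> carrier G"
      "\<And>M. M \<lhd> G \<Longrightarrow> (\<And>g. g \<in> E \<Longrightarrow> g \<in> M \<longleftrightarrow> g \<in> N) \<Longrightarrow> N \<subseteq> M"
      "\<And>M. M \<lhd> G \<Longrightarrow> (\<And>g. g \<in> E \<Longrightarrow> g \<in> M \<longleftrightarrow> g \<in> N) \<Longrightarrow> M \<noteq> N \<Longrightarrow> \<not> finite_index N M"
      using normal_extension_infinite_index_nhd[OF NG noeth] by blast
    define T where "T = {M. M \<lhd> G \<and> (\<forall>g\<in>E. g \<in> M \<longleftrightarrow> g \<in> N)}"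
    have "N \<in> T \<and> openin ?X T"
      unfolding T_def using NG openin_normal_subgroup_space_basic[OF E(1,2)] by simp
    moreover have "\<forall>T. N \<in> T \<and> openin ?X T \<longrightarrow> (\<exists>M\<noteq>N. M \<in> ?D n \<and> M \<in> T)"
      using N(2) unfolding in_derived_set_of by (rule conjunct2)
    ultimately obtain M where M: "M \<noteq> N" "M \<in> ?D n" "M \<in> T" by blast
    have MG: "M \<lhd> G" using M(2) by simp
    have "N \<subseteq> M" "\<not> finite_index N M" using E(3,4)[OF MG] M(1,3) unfolding T_def by blast+
    moreover have "infinite_index_chain (hirsch_dim N) N"
      using chain_iff[OF normal_imp_subgroup[OF NG]] by simp
    ultimately have "infinite_index_chain (Suc (hirsch_dim N)) M"
      using normal_imp_subgroup[OF NG] by auto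
    then have "Suc (hirsch_dim N) \<le> hirsch_dim M"
      using chain_iff[OF normal_imp_subgroup[OF MG]] by simp
    then show ?thesis using M(2) NG by simp
  qed
  have lower: "N \<in> ?D n \<inter> ?X derived_set_of ?D n" if N: "N \<in> ?D (Suc n)" for N
  proof -
    have NG: "N \<lhd> G" using N by simp
    note Nsg = normal_imp_subgroup[OF NG]
    \<comment> \<open>Finite index would give \<open>N\<close> the dimension of \<open>G\<close>,
      but membership in \<open>?D (Suc n)\<close> makes it strictly smaller.\<close>
    have inf: "\<not> finite_index N (carrier G)"
    proof
      assume "finite_index N (carrier G)"
      then have "infinite_index_chain (hirsch_dim (carrier G)) N"
        using infinite_index_chain_finite_index[OF Nsg subgroup_self subgroup.subset[OF Nsg]]
          chain_iff[OF subgroup_self] by simp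
      then show False using N chain_iff[OF Nsg] by simp
    qed
    obtain z where z: "z \<in> carrier G" "\<And>g. g \<in> carrier G \<Longrightarrow> commutator z g \<in> N"
      "\<And>m::nat. m > 0 \<Longrightarrow> z [^] m \<notin> N"
      using central_infinite_order_mod[OF nil NG inf noeth] by blast
    have "\<exists>M\<noteq>N. M \<in> ?D n \<and> M \<in> T" if T: "N \<in> T" "openin ?X T" for T
    proof -
      obtain E where E: "finite E" "E \<subseteq> carrier G"
        "\<And>M. M \<lhd> G \<Longrightarrow> (\<And>g. g \<in> E \<Longrightarrow> g \<in> M \<longleftrightarrow> g \<in> N) \<Longrightarrow> M \<in> T"
        using openin_normal_subgroup_space_nhd[OF T(2,1)] by blast
      obtain y where y: "y \<in> carrier G" "y \<notin> N" "\<And>g. g \<in> carrier G \<Longrightarrow> commutator y g \<in> N"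
        "\<And>g. g \<in> E \<Longrightarrow> g \<in> adjoin N y \<Longrightarrow> g \<in> N"
        using adjoin_avoiding[OF NG z E(1,2)] by blast
      have M: "adjoin N y \<lhd> G" using NG y(1,3) by (rule adjoin_normal)
      note A = adjoin[OF NG y(1)]
      \<comment> \<open>The one unit lost here is the difference between \<open>?D (Suc n)\<close>
        and \<open>?D n\<close>.\<close>
      have "hirsch_dim (adjoin N y) \<le> Suc (hirsch_dim N)"
      proof (cases "hirsch_dim (adjoin N y)")
        case (Suc m)
        then have "infinite_index_chain (Suc m) (adjoin N y)" using chain_iff[OF A(1)] by simp
        then have "infinite_index_chain m N"
          using infinite_index_chain_cyclic_extension[OF A(4)] by blast
        then show ?thesis using chain_iff[OF Nsg] Suc by simp
      qed simp
      then have "adjoin N y \<in> ?D n" using M N by simp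
      moreover have "adjoin N y \<noteq> N" using A(3) y(2) by blast
      moreover have "adjoin N y \<in> T" using E(3)[OF M] y(4) A(2) by blast
      ultimately show ?thesis by blast
    qed
    then have "\<forall>T. N \<in> T \<and> openin ?X T \<longrightarrow> (\<exists>M\<noteq>N. M \<in> ?D n \<and> M \<in> T)" by blast
    moreover have "N \<in> topspace ?X" using NG by (simp add: topspace_normal_subgroup_space)
    ultimately have "N \<in> ?X derived_set_of ?D n" unfolding in_derived_set_of by (intro conjI)
    moreover have "N \<in> ?D n" using N by simp
    ultimately show ?thesis by (intro IntI)
  qed
  show ?case unfolding eq by (rule equalityI[OF subsetI[OF upper] subsetI[OF lower]])
qed

end

theorem proposition1p1:
  fixes G (structure)
  assumes "group G" and "finitely_generated G" and "nilpotent G"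
  shows "cb_rank G = Some (finite_ordinal (hirsch_length G))"
proof -
  interpret group G by (rule assms(1))
  \<comment> \<open>With dimension zero, the condition for the trivial subgroup to survive to stage
    \<open>m\<close> becomes \<open>m \<le> hirsch_dim (carrier G)\<close>.\<close>
  have "hirsch_dim {\<one>} = 0"
    using infinite_index_chain_trivial by (rule hirsch_dim_eqI)
  then have "{\<one>} \<in> cb_derivative (normal_subgroup_space G) (finite_ordinal m :: ('a set + nat) ordinal)
      \<longleftrightarrow> m \<le> hirsch_length G" for m
    using one_is_normal hirsch_length_eq_hirsch_dim[OF nilpotent_polycyclic[OF assms(2,3)]]
    by (simp add: cb_derivative_normal_subgroup_space[OF assms(2,3) sum_nat_ordinal_no_top])
  then show ?thesis unfolding cb_rank_def by (rule cb_rank_at_eq_finite_ordinal)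
qed

end
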